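(* Suppose $2\mu\bar c\le \sigma^2 r$. Then $V(x,c)=g(x)$ for all $(x,c)\in\mathcal{Q}$, and the constant strategy $\mathcal{C}^*_t\equiv \bar c$ is an optimal dividend ratcheting strategy for the problem defining $V(x,c)$, i.e. it attains the supremum.
   Context: Let $(\Omega,\mathcal{F},\mathbb{P},\{\mathcal{F}_t\}_{t\ge0})$ be a complete filtered probability space whose filtration is generated by a standard one-dimensional Brownian motion $\{W_t\}_{t\ge0}$, augmented with all $\mathbb{P}$-null sets. Fix constants $\mu>0$, $\sigma>0$, $r>0$ and $\bar c\in[0,\mu]$. Write $\mathbb{R}^+=[0,\infty)$ and $\mathcal{Q}=\mathbb{R}^+\times[0,\bar c]$. For $c\in[0,\bar c]$, $\Pi_{[c,\bar c]}$ is the set of admissible dividend ratcheting strategies: $\{\mathcal{F}_t\}$-adapted, non-decreasing processes $\{\mathcal{C}_t\}_{t\ge0}$ with $c\le \mathcal{C}_t\le\bar c$ for all $t\ge0$. Given such a strategy and $x\in\mathbb{R}^+$, the surplus process is $dX_t=(\mu-\mathcal{C}_t)\,dt+\sigma\,dW_t$, $X_0=x$, and the ruin time is $\tau=\inf\{t\ge0: X_t\le0\}$. The value function is $$V(x,c)=\sup_{\{\mathcal{C}_t\}\in\Pi_{[c,\bar c]}}\mathbb{E}\Big[\int_0^\tau e^{-rt}\mathcal{C}_t\,dt\ \Big|\ X_0=x\Big],\quad (x,c)\in\mathcal{Q}.$$ Define $$g(x)=\frac{\bar c}{r}\big(1-e^{-\gamma x}\big),\quad x\in\mathbb{R}^+,\qquad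 \gamma=\frac{(\mu-\bar c)+\sqrt{(\mu-\bar c)^2+2\sigma^2 r}}{\sigma^2}>0.$$ *)

theory Defs
  imports "HOL-Probability.Probability"
begin

text \<open>Processes are functions of type \<^typ>\<open>real \<Rightarrow> 'a \<Rightarrow> real\<close>; only times \<open>t \<ge> 0\<close> are
  relevant, and values at negative times are never constrained nor used.\<close>

definition natural_filtration :: "'a measure \<Rightarrow> (real \<Rightarrow> 'a \<Rightarrow> real) \<Rightarrow> real \<Rightarrow> 'a measure" where
  "natural_filtration M W t =
     sigma (space M) {W s -` B \<inter> space M | s B. 0 \<le> s \<and> s \<le> t \<and> B \<in> sets borel}"

definition augmented_filtration :: "'a measure \<Rightarrow> (real \<Rightarrow> 'a \<Rightarrow> real) \<Rightarrow> real \<Rightarrow> 'a measure" where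
  "augmented_filtration M W t =
     sigma (space M) (sets (natural_filtration M W t) \<union> null_sets M)"

text \<open>A standard one-dimensional Brownian motion started at 0 on a complete probability space.
  Independence of increments is expressed relative to the past of \<open>W\<close> itself.\<close>

locale standard_brownian_motion = prob_space M + complete_measure M
  for M :: "'a measure" and W :: "real \<Rightarrow> 'a \<Rightarrow> real" +
  assumes measurable_W: "\<And>t. 0 \<le> t \<Longrightarrow> W t \<in> borel_measurable M"
    and start_0: "AE \<omega> in M. W 0 \<omega> = 0"
    and continuous_paths: "AE \<omega> in M. continuous_on {0..} (\<lambda>t. W t \<omega>)"
    and normal_increments: "\<And>s t. 0 \<le> s \<Longrightarrow> s < t \<Longrightarrow>
      distributed M lborel (\<lambda>\<omega>. W t \<omega> - W s \<omega>) (normal_density 0 (sqrt (t - s)))"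
    and independent_increments: "\<And>s t. 0 \<le> s \<Longrightarrow> s < t \<Longrightarrow>
      indep_set (sets (natural_filtration M W s))
                (sets (vimage_algebra (space M) (\<lambda>\<omega>. W t \<omega> - W s \<omega>) borel))"

definition ratcheting_strategies ::
  "'a measure \<Rightarrow> (real \<Rightarrow> 'a \<Rightarrow> real) \<Rightarrow> real \<Rightarrow> real \<Rightarrow> (real \<Rightarrow> 'a \<Rightarrow> real) set" where
  "ratcheting_strategies M W cbar c =
     {C. (\<forall>t\<ge>0. C t \<in> borel_measurable (augmented_filtration M W t)) \<and>
         (\<forall>\<omega>\<in>space M. mono_on {0..} (\<lambda>t. C t \<omega>)) \<and>
         (\<forall>\<omega>\<in>space M. \<forall>t\<ge>0. c \<le> C t \<omega> \<and> C t \<omega> \<le> cbar)}"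

text \<open>The solution of \<open>dX = (\<mu> - C) dt + \<sigma> dW\<close>, \<open>X\<^sub>0 = x\<close>: as \<open>\<sigma>\<close> is constant, the
  stochastic integral of \<open>\<sigma>\<close> up to time \<open>t\<close> is \<open>\<sigma> * W\<^sub>t\<close>.\<close>

definition surplus ::
  "real \<Rightarrow> real \<Rightarrow> (real \<Rightarrow> 'a \<Rightarrow> real) \<Rightarrow> real \<Rightarrow> (real \<Rightarrow> 'a \<Rightarrow> real) \<Rightarrow> real \<Rightarrow> 'a \<Rightarrow> real" where
  "surplus \<mu> \<sigma> W x C t \<omega> = x + (LBINT s=0..t. \<mu> - C s \<omega>) + \<sigma> * W t \<omega>"

text \<open>The value is \<open>\<infinity>\<close>, the infimum of the empty set, if ruin never occurs.\<close>

definition ruin_time ::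
  "real \<Rightarrow> real \<Rightarrow> (real \<Rightarrow> 'a \<Rightarrow> real) \<Rightarrow> real \<Rightarrow> (real \<Rightarrow> 'a \<Rightarrow> real) \<Rightarrow> 'a \<Rightarrow> ereal" where
  "ruin_time \<mu> \<sigma> W x C \<omega> = Inf (ereal ` {t. 0 \<le> t \<and> surplus \<mu> \<sigma> W x C t \<omega> \<le> 0})"

definition expected_dividends ::
  "'a measure \<Rightarrow> (real \<Rightarrow> 'a \<Rightarrow> real) \<Rightarrow> real \<Rightarrow> real \<Rightarrow> real \<Rightarrow> real \<Rightarrow> (real \<Rightarrow> 'a \<Rightarrow> real) \<Rightarrow> real"
where
  "expected_dividends M W \<mu> \<sigma> r x C =
     (\<integral>\<omega>. (LBINT t=0..ruin_time \<mu> \<sigma> W x C \<omega>. exp (- r * t) * C t \<omega>) \<partial>M)"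

text \<open>The supremum is over a nonempty set bounded by \<open>cbar / r\<close> in the intended range
  \<open>0 \<le> c \<le> cbar\<close>, \<open>r > 0\<close>, so the real-valued \<^const>\<open>Sup\<close> is the genuine one.\<close>

definition value_function ::
  "'a measure \<Rightarrow> (real \<Rightarrow> 'a \<Rightarrow> real) \<Rightarrow> real \<Rightarrow> real \<Rightarrow> real \<Rightarrow> real \<Rightarrow> real \<Rightarrow> real \<Rightarrow> real" where
  "value_function M W \<mu> \<sigma> r cbar x c =
     (SUP C \<in> ratcheting_strategies M W cbar c. expected_dividends M W \<mu> \<sigma> r x C)"

definition optimal_strategy ::
  "'a measure \<Rightarrow> (real \<Rightarrow> 'a \<Rightarrow> real) \<Rightarrow> real \<Rightarrow> real \<Rightarrow> real \<Rightarrow> real \<Rightarrow> real \<Rightarrow> real \<Rightarrow>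
    (real \<Rightarrow> 'a \<Rightarrow> real) \<Rightarrow> bool" where
  "optimal_strategy M W \<mu> \<sigma> r cbar x c C \<longleftrightarrow>
     C \<in> ratcheting_strategies M W cbar c \<and>
     (\<forall>D \<in> ratcheting_strategies M W cbar c.
        expected_dividends M W \<mu> \<sigma> r x D \<le> expected_dividends M W \<mu> \<sigma> r x C) \<and>
     expected_dividends M W \<mu> \<sigma> r x C = value_function M W \<mu> \<sigma> r cbar x c"

definition gamma_exponent :: "real \<Rightarrow> real \<Rightarrow> real \<Rightarrow> real \<Rightarrow> real" where
  "gamma_exponent \<mu> \<sigma> r cbar = ((\<mu> - cbar) + sqrt ((\<mu> - cbar)\<^sup>2 + 2 * \<sigma>\<^sup>2 * r)) / \<sigma>\<^sup>2"

definition g_fun :: "real \<Rightarrow> real \<Rightarrow> real \<Rightarrow> real \<Rightarrow> real \<Rightarrow> real" where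
  "g_fun \<mu> \<sigma> r cbar x = cbar / r * (1 - exp (- gamma_exponent \<mu> \<sigma> r cbar * x))"

end

theory Submission
  imports Defs "HOL-Real_Asymp.Real_Asymp"
begin

text \<open>The verification argument, carried out in discrete time so that no stochastic calculus is
  needed. The function \<open>g\<close> solves the HJB equation at the rate \<open>cbar\<close>, and \<open>2 * \<mu> * cbar \<le> \<sigma>\<^sup>2 * r\<close>
  says that \<open>g' \<le> 1\<close>, so \<open>g\<close> is a supersolution for every rate in \<open>[0, cbar]\<close>. On a grid of mesh
  \<open>h\<close>, monotonicity of a strategy bounds its surplus and its dividends by those of the strategy
  frozen on grid cells, up to \<open>O(h)\<close>. The increments of the frozen surplus have explicit
  exponential moments, so the discounted values \<open>g(X + \<delta>)\<close> of it form a supermartingale up to an error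
  that vanishes as \<open>h \<rightarrow> 0\<close>; then \<open>\<delta> \<rightarrow> 0\<close> bounds the dividends by \<open>g(x)\<close>. For the constant
  rate \<open>cbar\<close> the process \<open>exp (- r * t - \<gamma> * X\<^sub>t)\<close> is a martingale; stopping it on
  the grid at the first entrance below \<open>a > 0\<close> gives \<open>E (exp (- r * \<tau>)) \<le> exp (- \<gamma> * x)\<close>, hence equality.\<close>

section \<open>Integrals over grid cells and Gaussian exponential moments\<close>

lemma grid_index:
  fixes h s :: real
  assumes "h > 0" "0 \<le> s" "s < real K * h"
  obtains k where "k < K" "real k * h \<le> s" "s < real (Suc k) * h"
proof
  define k where "k = nat \<lfloor>s / h\<rfloor>"
  have k: "real k = of_int \<lfloor>s / h\<rfloor>"
    unfolding k_def using assms by simp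
  have "real k \<le> s / h" "s / h < real k + 1"
    unfolding k by linarith+
  then show *: "real k * h \<le> s" "s < real (Suc k) * h"
    using assms(1) by (auto simp: field_simps)
  have "real k * h < real K * h" using * assms by linarith
  then show "k < K" using assms(1) by simp
qed

text \<open>The dominating function, a step function followed by the tail \<open>b\<close>, is
  nonnegative and integrable. That suffices for the comparison whatever \<open>f\<close> is, since a
  non-integrable \<open>f\<close> has integral 0 by convention.\<close>

lemma lborel_integral_le_step_sum:
  fixes f b :: "real \<Rightarrow> real" and a :: "nat \<Rightarrow> real"
  assumes "h > 0"
    and neg: "\<And>s. s < 0 \<Longrightarrow> f s \<le> 0"
    and step: "\<And>k s. k < K \<Longrightarrow> real k * h \<le> s \<Longrightarrow> s < real (Suc k) * h \<Longrightarrow> f s \<le> a k"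
    and tail: "\<And>s. real K * h \<le> s \<Longrightarrow> f s \<le> b s"
    and a: "\<And>k. k < K \<Longrightarrow> 0 \<le> a k"
    and b: "\<And>s. 0 \<le> b s" "set_integrable lborel {real K * h..} b"
  shows "(LBINT s. f s) \<le> h * (\<Sum>k<K. a k) + (LBINT s:{real K * h..}. b s)"
proof -
  let ?I = "\<lambda>k. {real k * h..<real (Suc k) * h}"
  define F where "F = (\<lambda>s. (\<Sum>k<K. indicator (?I k) s * a k) + indicator {real K * h..} s * b s)"
  have len: "measure lborel (?I k) = h" for k
    using \<open>h > 0\<close> by (subst measure_lborel_Ico) (auto simp: algebra_simps)
  have fin: "emeasure lborel (?I k) < \<infinity>" for k
    using \<open>h > 0\<close> by (subst emeasure_lborel_Ico) (auto simp: algebra_simps)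
  have int1: "integrable lborel (\<lambda>s. indicator (?I k) s * a k)" for k
    by (intro integrable_mult_left integrable_real_indicator fin) auto
  have int2: "integrable lborel (\<lambda>s. indicator {real K * h..} s * b s)"
    using b(2) by (simp add: set_integrable_def)
  have nn: "0 \<le> indicator (?I k) s * a k" if "k < K" for k s
    using a[OF that] by simp
  have F0: "0 \<le> F s" for s
    unfolding F_def using nn b(1) by (intro add_nonneg_nonneg sum_nonneg) auto
  have le: "f s \<le> F s" for s
  proof -
    consider "s < 0" | "0 \<le> s" "s < real K * h" | "real K * h \<le> s" by linarith
    then show ?thesis
    proof cases
      case 1
      then show ?thesis using neg[OF 1] F0[of s] by linarith
    next
      case 2
      then obtain k where k: "k < K" "real k * h \<le> s" "s < real (Suc k) * h"
        using grid_index \<open>h > 0\<close> by blast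
      have "f s \<le> indicator (?I k) s * a k" using step[OF k] k by (simp add: indicator_def)
      also have "\<dots> \<le> (\<Sum>k<K. indicator (?I k) s * a k)"
        using k(1) nn by (intro member_le_sum) auto
      also have "\<dots> \<le> F s" unfolding F_def using b(1) by simp
      finally show ?thesis .
    next
      case 3
      have "f s \<le> indicator {real K * h..} s * b s" using tail[OF 3] 3 by simp
      also have "\<dots> \<le> F s"
        unfolding F_def using sum_nonneg[of "{..<K}" "\<lambda>k. indicator (?I k) s * a k"] nn by auto
      finally show ?thesis .
    qed
  qed
  have "integrable lborel F"
    unfolding F_def by (intro Bochner_Integration.integrable_add Bochner_Integration.integrable_sum int1 int2)
  then have "(LBINT s. f s) \<le> (LBINT s. F s)"
    by (rule integral_mono') (use le F0 in auto)
  also have "\<dots> = (LBINT s. \<Sum>k<K. indicator (?I k) s * a k) + (LBINT s. indicator {real K * h..} s * b s)"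
    unfolding F_def
    by (intro Bochner_Integration.integral_add Bochner_Integration.integrable_sum int1 int2)
  also have "(LBINT s. \<Sum>k<K. indicator (?I k) s * a k) = (\<Sum>k<K. (LBINT s. indicator (?I k) s * a k))"
    by (intro Bochner_Integration.integral_sum int1)
  also have "(\<Sum>k<K. (LBINT s. indicator (?I k) s * a k)) = h * (\<Sum>k<K. a k)"
    using len by (simp add: sum_distrib_left)
  finally show ?thesis by (simp add: set_lebesgue_integral_def)
qed

lemma exp_tail_integral:
  fixes r a :: real
  assumes "r > 0"
  shows "set_integrable lborel {a..} (\<lambda>s. exp (- r * s))"
    and "(LBINT s:{a..}. exp (- r * s)) = exp (- r * a) / r"
proof -
  have "(\<integral>\<^sup>+x. ennreal (exp (- r * x)) * indicator {a..} x \<partial>lborel) = ennreal (0 - (- exp (- r * a) / r))"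
  proof (rule nn_integral_FTC_atLeast)
    show "DERIV (\<lambda>x. - exp (- r * x) / r) x :> exp (- r * x)" if "a \<le> x" for x
      using assms by (auto intro!: derivative_eq_intros)
    show "((\<lambda>x. - exp (- r * x) / r) \<longlongrightarrow> 0) at_top"
      using assms by real_asymp
  qed auto
  then have "(\<integral>\<^sup>+x. ennreal (indicator {a..} x * exp (- r * x)) \<partial>lborel) = ennreal (exp (- r * a) / r)"
    by (subst nn_integral_cong[where v="\<lambda>x. ennreal (exp (- r * x)) * indicator {a..} x"])
      (auto split: split_indicator)
  then have "has_bochner_integral lborel (\<lambda>x. indicator {a..} x * exp (- r * x)) (exp (- r * a) / r)"
    using assms by (intro has_bochner_integral_nn_integral) auto
  then show "set_integrable lborel {a..} (\<lambda>s. exp (- r * s))"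
    "(LBINT s:{a..}. exp (- r * s)) = exp (- r * a) / r"
    by (auto simp: set_integrable_def set_lebesgue_integral_def has_bochner_integral_iff mult.commute)
qed

text \<open>Completing the square: tilting a centred normal density by \<open>exp (l * z)\<close>
  gives a constant multiple of the normal density with mean \<open>l * s\<^sup>2\<close>.\<close>

lemma normal_exp_moment:
  assumes "s > 0"
  shows "has_bochner_integral lborel (\<lambda>z. normal_density 0 s z * exp (l * z)) (exp (l\<^sup>2 * s\<^sup>2 / 2))"
proof -
  have eq: "normal_density 0 s z * exp (l * z) = exp (l\<^sup>2 * s\<^sup>2 / 2) * normal_density (l * s\<^sup>2) s z" for z
  proof -
    have "- z\<^sup>2 / (2 * s\<^sup>2) + l * z = l\<^sup>2 * s\<^sup>2 / 2 - (z - l * s\<^sup>2)\<^sup>2 / (2 * s\<^sup>2)"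
      using assms by (simp add: field_simps power2_eq_square)
    then have "exp (- z\<^sup>2 / (2 * s\<^sup>2)) * exp (l * z) = exp (l\<^sup>2 * s\<^sup>2 / 2) * exp (- (z - l * s\<^sup>2)\<^sup>2 / (2 * s\<^sup>2))"
      by (simp add: exp_add[symmetric])
    then show ?thesis by (simp add: normal_density_def)
  qed
  have "has_bochner_integral lborel (\<lambda>z. exp (l\<^sup>2 * s\<^sup>2 / 2) * normal_density (l * s\<^sup>2) s z) (exp (l\<^sup>2 * s\<^sup>2 / 2) * 1)"
    using assms by (intro has_bochner_integral_mult_right) (simp add: has_bochner_integral_iff)
  then show ?thesis by (simp add: eq)
qed

section \<open>The augmented filtration and its independence of future increments\<close>

lemma augmented_filtration_generator:
  "sets (natural_filtration M W t) \<union> null_sets M \<subseteq> Pow (space M)"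
proof -
  have "space (natural_filtration M W t) = space M"
    unfolding natural_filtration_def by (rule space_measure_of) auto
  then show ?thesis
    using sets.space_closed[of "natural_filtration M W t"] sets.space_closed[of M] by auto
qed

lemma sets_augmented_filtration:
  "sets (augmented_filtration M W t) =
    sigma_sets (space M) (sets (natural_filtration M W t) \<union> null_sets M)"
  unfolding augmented_filtration_def
  by (rule sets_measure_of[OF augmented_filtration_generator])

lemma space_augmented_filtration[simp]: "space (augmented_filtration M W t) = space M"
  unfolding augmented_filtration_def
  by (rule space_measure_of[OF augmented_filtration_generator])

lemma space_natural_filtration[simp]: "space (natural_filtration M W t) = space M"
  unfolding natural_filtration_def by (rule space_measure_of) auto

lemma sets_natural_filtration:
  "sets (natural_filtration M W t) =
    sigma_sets (space M) {W s -` B \<inter> space M | s B. 0 \<le> s \<and> s \<le> t \<and> B \<in> sets borel}"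
  unfolding natural_filtration_def by (rule sets_measure_of) auto

lemma sets_natural_filtration_mono:
  "s \<le> t \<Longrightarrow> sets (natural_filtration M W s) \<subseteq> sets (natural_filtration M W t)"
  unfolding sets_natural_filtration by (rule sigma_sets_mono') force

lemma measurable_augmented_mono:
  assumes "f \<in> borel_measurable (augmented_filtration M W s)" "s \<le> t"
  shows "f \<in> borel_measurable (augmented_filtration M W t)"
proof -
  have "sets (augmented_filtration M W s) \<subseteq> sets (augmented_filtration M W t)"
    unfolding sets_augmented_filtration
    by (rule sigma_sets_mono') (use sets_natural_filtration_mono[OF assms(2)] in blast)
  then show ?thesis
    using assms(1) measurable_mono[of borel borel "augmented_filtration M W s" "augmented_filtration M W t"] by auto
qed

lemma process_measurable_augmented:
  fixes W :: "real \<Rightarrow> 'a \<Rightarrow> real"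
  assumes "0 \<le> t"
  shows "W t \<in> borel_measurable (augmented_filtration M W t)"
proof (rule measurableI)
  fix A :: "real set" assume "A \<in> sets borel"
  then have "W t -` A \<inter> space M \<in> sets (natural_filtration M W t)"
    unfolding sets_natural_filtration using assms by (intro sigma_sets.Basic) auto
  then show "W t -` A \<inter> space (augmented_filtration M W t) \<in> sets (augmented_filtration M W t)"
    unfolding sets_augmented_filtration by (auto intro!: sigma_sets.Basic)
qed auto

context standard_brownian_motion
begin

lemma sets_natural_filtration_subset: "sets (natural_filtration M W t) \<subseteq> sets M"
  unfolding sets_natural_filtration
  by (rule sets.sigma_sets_subset) (auto intro!: measurable_sets[OF measurable_W])

lemma sets_augmented_filtration_subset: "sets (augmented_filtration M W t) \<subseteq> sets M"
  unfolding sets_augmented_filtration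
  by (rule sets.sigma_sets_subset) (use sets_natural_filtration_subset in auto)

lemma measurable_augmented:
  "f \<in> borel_measurable (augmented_filtration M W t) \<Longrightarrow> f \<in> borel_measurable M"
  using measurable_mono[of borel borel "augmented_filtration M W t" M] sets_augmented_filtration_subset by auto

text \<open>The sets that agree almost surely with a set of the natural filtration form a
  sigma-algebra, and it contains all null sets. This carries independence over to the
  augmentation.\<close>

lemma augmented_AE_natural:
  assumes "A \<in> sets (augmented_filtration M W t)"
  shows "\<exists>A'\<in>sets (natural_filtration M W t). AE \<omega> in M. \<omega> \<in> A \<longleftrightarrow> \<omega> \<in> A'"
  using assms unfolding sets_augmented_filtration
proof (induction rule: sigma_sets.induct)
  case (Basic a)
  then show ?case
  proof
    assume "a \<in> null_sets M"
    then have "AE \<omega> in M. \<omega> \<in> a \<longleftrightarrow> \<omega> \<in> {}" by (auto dest: AE_not_in)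
    then show ?thesis by blast
  qed auto
next
  case Empty
  then show ?case by (auto intro!: bexI[of _ "{}"])
next
  case (Compl a)
  then obtain A' where A': "A' \<in> sets (natural_filtration M W t)" "AE \<omega> in M. \<omega> \<in> a \<longleftrightarrow> \<omega> \<in> A'"
    by blast
  have "space M - A' \<in> sets (natural_filtration M W t)"
    using sets.compl_sets[OF A'(1)] by simp
  moreover have "AE \<omega> in M. \<omega> \<in> space M - a \<longleftrightarrow> \<omega> \<in> space M - A'"
    using A'(2) by eventually_elim auto
  ultimately show ?case by blast
next
  case (Union a)
  then obtain A' where A': "\<And>i::nat. A' i \<in> sets (natural_filtration M W t)"
    "\<And>i. AE \<omega> in M. \<omega> \<in> a i \<longleftrightarrow> \<omega> \<in> A' i"
    by metis
  have "AE \<omega> in M. \<forall>i. \<omega> \<in> a i \<longleftrightarrow> \<omega> \<in> A' i"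
    using A'(2) by (simp add: AE_all_countable)
  then have "AE \<omega> in M. \<omega> \<in> (\<Union>i. a i) \<longleftrightarrow> \<omega> \<in> (\<Union>i. A' i)"
    by eventually_elim auto
  moreover have "(\<Union>i. A' i) \<in> sets (natural_filtration M W t)" using A'(1) by auto
  ultimately show ?case by blast
qed

text \<open>Independence is assumed for the natural filtration only. Replacing an event of the
  augmented one by an almost surely equal natural event changes no probability in the product
  formula.\<close>

lemma indep_augmented_increment:
  assumes "0 \<le> s" "s < t" and U: "U \<in> borel_measurable (augmented_filtration M W s)"
  shows "indep_var borel U borel (\<lambda>\<omega>. W t \<omega> - W s \<omega>)"
proof -
  let ?V = "\<lambda>\<omega>. W t \<omega> - W s \<omega>"
  have V: "?V \<in> borel_measurable M" using measurable_W assms by auto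
  have setsV: "sets (vimage_algebra (space M) ?V borel) = sigma_sets (space M) {?V -` A \<inter> space M |A. A \<in> sets borel}"
    unfolding vimage_algebra_def by (rule sets_measure_of) auto
  have ind: "indep_set (sets (augmented_filtration M W s)) (sets (vimage_algebra (space M) ?V borel))"
    unfolding indep_sets2_eq
  proof (intro conjI ballI)
    show "sets (augmented_filtration M W s) \<subseteq> events" by (rule sets_augmented_filtration_subset)
    show "sets (vimage_algebra (space M) ?V borel) \<subseteq> events"
      using independent_increments[OF assms(1,2)] by (rule indep_setD_ev2)
    fix a b assume ab: "a \<in> sets (augmented_filtration M W s)" "b \<in> sets (vimage_algebra (space M) ?V borel)"
    obtain a' where a': "a' \<in> sets (natural_filtration M W s)" "AE \<omega> in M. \<omega> \<in> a \<longleftrightarrow> \<omega> \<in> a'"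
      using augmented_AE_natural[OF ab(1)] by blast
    have ev: "a \<in> events" "a' \<in> events" "b \<in> events"
      using ab a' sets_augmented_filtration_subset sets_natural_filtration_subset
        indep_setD_ev2[OF independent_increments[OF assms(1,2)]] by auto
    have "prob (a \<inter> b) = prob (a' \<inter> b)"
      by (rule finite_measure_eq_AE) (use a'(2) ev in auto)
    also have "\<dots> = prob a' * prob b"
      by (rule indep_setD[OF independent_increments[OF assms(1,2)] a'(1) ab(2)])
    also have "prob a' = prob a"
      by (rule finite_measure_eq_AE) (use a'(2) ev in auto)
    finally show "prob (a \<inter> b) = prob a * prob b" .
  qed
  have sub: "sigma_sets (space M) {U -` A \<inter> space M |A. A \<in> sets borel} \<subseteq> sets (augmented_filtration M W s)"
    using sets.sigma_sets_subset[of "{U -` A \<inter> space M |A. A \<in> sets borel}" "augmented_filtration M W s"]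
      measurable_sets[OF U] by auto
  show ?thesis
    unfolding indep_var_eq
    using measurable_augmented[OF U] V ind sub setsV
    unfolding indep_sets2_eq by blast
qed

lemma increment_exp_moment:
  assumes "0 \<le> s" "s < t"
  shows "has_bochner_integral M (\<lambda>\<omega>. exp (l * (W t \<omega> - W s \<omega>))) (exp (l\<^sup>2 * (t - s) / 2))"
proof -
  have D: "distributed M lborel (\<lambda>\<omega>. W t \<omega> - W s \<omega>) (normal_density 0 (sqrt (t - s)))"
    using normal_increments assms by blast
  have "has_bochner_integral lborel (\<lambda>z. normal_density 0 (sqrt (t - s)) z * exp (l * z)) (exp (l\<^sup>2 * (t - s) / 2))"
    using normal_exp_moment[of "sqrt (t - s)" l] assms by simp
  then show ?thesis
    using distributed_integral[OF D, of "\<lambda>z. exp (l * z)"] distributed_integrable[OF D, of "\<lambda>z. exp (l * z)"]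
    by (simp add: has_bochner_integral_iff)
qed

text \<open>Takes the place of conditioning on the past at time \<open>s\<close>: the factor
  \<open>U\<close> is known by then, and the increment contributes its exponential moment.\<close>

lemma expectation_mult_exp_increment:
  assumes "0 \<le> s" "s < t"
    and U: "U \<in> borel_measurable (augmented_filtration M W s)" "integrable M U"
  shows "has_bochner_integral M (\<lambda>\<omega>. U \<omega> * exp (l * (W t \<omega> - W s \<omega>)))
    (expectation U * exp (l\<^sup>2 * (t - s) / 2))"
proof -
  have "indep_var borel (id \<circ> U) borel ((\<lambda>z. exp (l * z)) \<circ> (\<lambda>\<omega>. W t \<omega> - W s \<omega>))"
    by (rule indep_var_compose[OF indep_augmented_increment[OF assms(1-3)]]) auto
  then have ind: "indep_var borel U borel (\<lambda>\<omega>. exp (l * (W t \<omega> - W s \<omega>)))"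
    by (simp add: comp_def)
  note E = increment_exp_moment[OF assms(1,2), of l]
  show ?thesis
    using indep_var_lebesgue_integral[OF ind U(2)] indep_var_integrable[OF ind U(2)] E
    by (simp add: has_bochner_integral_iff)
qed

end

section \<open>Pathwise comparison with rates frozen on grid cells, and constant rates\<close>

text \<open>On each cell the discount is largest at the left end and the rate at the right end.
  Moving the rate back to the left end costs a telescoping sum, at most \<open>h * cbar\<close>; the
  last summand bounds all payments after time \<open>K * h\<close>. Cells that are not
  \<open>alive\<close> lie after \<open>T\<close> and pay nothing.\<close>

lemma pathwise_dividends_le:
  fixes d :: "real \<Rightarrow> real" and T :: ereal and alive :: "nat \<Rightarrow> bool"
  assumes "h > 0" "r > 0" and mono: "mono_on {0..} d"
    and d: "\<And>t. 0 \<le> t \<Longrightarrow> 0 \<le> d t \<and> d t \<le> cbar"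
    and "0 \<le> T"
    and dead: "\<And>k. \<not> alive k \<Longrightarrow> T \<le> ereal (real k * h)"
  shows "(LBINT t=0..T. exp (- r * t) * d t) \<le>
    (\<Sum>k<K. of_bool (alive k) * exp (- r * (real k * h)) * (h * d (real k * h)))
      + h * cbar + cbar / r * exp (- r * (real K * h))"
proof -
  define e where "e = (\<lambda>k. of_bool (alive k) * exp (- r * (real k * h)))"
  let ?f = "\<lambda>s. indicator (einterval 0 T) s * (exp (- r * s) * d s)"
  have cb: "0 \<le> cbar" using d[of 0] by simp
  have e: "0 \<le> e k" "e k \<le> 1" for k using assms(1,2) by (auto simp: e_def)
  have dm: "d (real k * h) \<le> d (real (Suc k) * h)" for k
    using assms(1) by (intro mono_onD[OF mono]) (auto intro: mult_right_mono)
  have dle: "d s \<le> d t" if "0 \<le> s" "s \<le> t" for s t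
    using that by (intro mono_onD[OF mono]) auto
  have "(LBINT t=0..T. exp (- r * t) * d t) = (LBINT s. ?f s)"
    using \<open>0 \<le> T\<close> by (simp add: interval_lebesgue_integral_le_eq set_lebesgue_integral_def)
  also have "\<dots> \<le> h * (\<Sum>k<K. e k * d (real (Suc k) * h)) + (LBINT s:{real K * h..}. cbar * exp (- r * s))"
  proof (rule lborel_integral_le_step_sum)
    show "?f s \<le> 0" if "s < 0" for s
      using that by (auto simp: indicator_def einterval_iff)
    show "?f s \<le> e k * d (real (Suc k) * h)" if "k < K" "real k * h \<le> s" "s < real (Suc k) * h" for k s
    proof (cases "s \<in> einterval 0 T")
      case False
      then show ?thesis using e d[of "real (Suc k) * h"] assms(1) by simp
    next
      case True
      then have s: "0 < s" "ereal s < T" by (auto simp: einterval_iff)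
      have "alive k"
      proof (rule ccontr)
        assume "\<not> alive k"
        then have "T \<le> ereal (real k * h)" by (rule dead)
        also have "\<dots> \<le> ereal s" using that by simp
        finally show False using s by simp
      qed
      moreover have "exp (- r * s) * d s \<le> exp (- r * (real k * h)) * d (real (Suc k) * h)"
        using that s d[of s] \<open>r > 0\<close> by (intro mult_mono dle) auto
      ultimately show ?thesis using True by (simp add: e_def)
    qed
    show "?f s \<le> cbar * exp (- r * s)" for s
      using d[of s] cb by (auto simp: indicator_def einterval_iff)
    show "0 \<le> e k * d (real (Suc k) * h)" for k using e d[of "real (Suc k) * h"] assms(1) by simp
    show "set_integrable lborel {real K * h..} (\<lambda>s. cbar * exp (- r * s))"
      using exp_tail_integral(1)[OF \<open>r > 0\<close>] by simp
  qed (use assms(1) cb in auto)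
  also have "(LBINT s:{real K * h..}. cbar * exp (- r * s)) = cbar / r * exp (- r * (real K * h))"
    using exp_tail_integral(2)[OF \<open>r > 0\<close>] by simp
  also have "h * (\<Sum>k<K. e k * d (real (Suc k) * h)) \<le> h * ((\<Sum>k<K. e k * d (real k * h)) + cbar)"
  proof (rule mult_left_mono)
    have "(\<Sum>k<K. e k * d (real (Suc k) * h)) - (\<Sum>k<K. e k * d (real k * h))
        = (\<Sum>k<K. e k * (d (real (Suc k) * h) - d (real k * h)))"
      by (simp add: sum_subtractf right_diff_distrib)
    \<comment> \<open>The increments of \<open>d\<close> are nonnegative, so the weights
      \<open>e k\<close> may be raised to 1, and then the sum telescopes.\<close>
    also have "\<dots> \<le> (\<Sum>k<K. 1 * (d (real (Suc k) * h) - d (real k * h)))"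
      using e dm by (intro sum_mono mult_right_mono) auto
    also have "\<dots> = d (real K * h) - d (real 0 * h)"
      unfolding mult_1_left by (rule sum_lessThan_telescope)
    also have "\<dots> \<le> cbar" using d[of "real K * h"] d[of 0] assms(1) by simp
    finally show "(\<Sum>k<K. e k * d (real (Suc k) * h)) \<le> (\<Sum>k<K. e k * d (real k * h)) + cbar" by simp
  qed (use assms in simp)
  finally have "(LBINT t=0..T. exp (- r * t) * d t) \<le>
      (\<Sum>k<K. e k * (h * d (real k * h))) + h * cbar + cbar / r * exp (- r * (real K * h))"
    by (simp add: sum_distrib_left algebra_simps)
  then show ?thesis unfolding e_def .
qed

text \<open>The net drift \<open>\<mu> - d\<close> is non-increasing, hence on each cell at most its
  value at the left end: freezing the rate can only raise the surplus.\<close>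

lemma pathwise_drift_le:
  fixes d :: "real \<Rightarrow> real"
  assumes "h > 0" and mono: "mono_on {0..} d"
    and d: "\<And>t. 0 \<le> t \<Longrightarrow> d t \<le> \<mu>"
  shows "(LBINT s=0..real K * h. \<mu> - d s) \<le> h * (\<Sum>k<K. \<mu> - d (real k * h))"
proof -
  let ?f = "\<lambda>s. indicator (einterval 0 (real K * h)) s * (\<mu> - d s)"
  have "(LBINT s=0..real K * h. \<mu> - d s) = (LBINT s. ?f s)"
    using assms by (subst interval_lebesgue_integral_le_eq) (simp_all add: set_lebesgue_integral_def)
  also have "\<dots> \<le> h * (\<Sum>k<K. \<mu> - d (real k * h)) + (LBINT s:{real K * h..}. 0)"
  proof (rule lborel_integral_le_step_sum)
    show "?f s \<le> \<mu> - d (real k * h)" if "k < K" "real k * h \<le> s" "s < real (Suc k) * h" for k s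
    proof -
      have k0: "0 \<le> real k * h" using assms(1) by simp
      have "d (real k * h) \<le> d s" using that k0 by (intro mono_onD[OF mono]) auto
      then show ?thesis using d[OF k0] by (auto simp: indicator_def)
    qed
  qed (use assms in \<open>auto simp: indicator_def einterval_iff set_integrable_def zero_ereal_def\<close>)
  finally show ?thesis by (simp add: set_lebesgue_integral_def)
qed

text \<open>The case \<open>T = \<infinity>\<close> is separate because
  \<open>real_of_ereal \<infinity> = 0\<close> would give the factor 1 instead of the limit
  0.\<close>

definition discount :: "real \<Rightarrow> ereal \<Rightarrow> real" where
  "discount r T = (if T = \<infinity> then 0 else exp (- r * real_of_ereal T))"

lemma discount_measurable: "discount r \<in> borel_measurable borel"
proof -
  have "(\<lambda>T::ereal. if T = \<infinity> then 0 else exp (- r * real_of_ereal T)) \<in> borel_measurable borel"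
    by measurable
  then show ?thesis by (simp only: discount_def[abs_def])
qed

lemma constant_dividends:
  fixes T :: ereal
  assumes "0 \<le> T" "r > 0"
  shows "(LBINT t=0..T. exp (- r * t) * c) = c / r * (1 - discount r T)"
proof (cases T)
  case (real u)
  have u: "0 \<le> u" using assms real by simp
  have "(LBINT t=ereal 0..ereal u. exp (- r * t) * c) = (- exp (- r * u) * c / r) - (- exp (- r * 0) * c / r)"
    using \<open>r > 0\<close> u
    by (intro interval_integral_FTC_finite continuous_intros)
      (auto intro!: derivative_eq_intros simp flip: has_real_derivative_iff_has_vector_derivative)
  also have "\<dots> = c / r * (1 - exp (- r * u))" using \<open>r > 0\<close> by (simp add: field_simps)
  finally show ?thesis using real by (simp add: discount_def zero_ereal_def)
next
  case PInf
  have "(LBINT t=0..T. exp (- r * t) * c) = (LBINT t:{0<..}. exp (- r * t) * c)"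
    by (simp add: interval_integral_to_infinity_eq PInf zero_ereal_def)
  also have "\<dots> = (LBINT t:{0..}. exp (- r * t) * c)"
    by (rule set_integral_discrete_difference[where X="{0}"]) auto
  also have "\<dots> = c / r"
    using exp_tail_integral(2)[OF \<open>r > 0\<close>, of 0] by simp
  finally show ?thesis using PInf by (simp add: discount_def)
qed (use assms in auto)

section \<open>The exponent \<open>\<gamma>\<close> and the scalar one-step inequality\<close>

text \<open>The product \<open>(1 - y + y\<^sup>2) * (1 + y)\<close> equals
  \<open>1 + y ^ 3\<close>, and \<open>1 + y\<close> is at most \<open>exp y\<close>.\<close>

lemma exp_minus_le_quadratic:
  fixes y :: real
  assumes "0 \<le> y"
  shows "exp (- y) \<le> 1 - y + y\<^sup>2"
proof -
  have "1 \<le> (1 - y + y\<^sup>2) * (1 + y)"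
    using assms by (simp add: algebra_simps power2_eq_square)
  also have "\<dots> \<le> (1 - y + y\<^sup>2) * exp y"
  proof (rule mult_left_mono)
    have "1 - y + y\<^sup>2 = (y - 1/2)\<^sup>2 + 3/4" by (simp add: power2_eq_square algebra_simps)
    then show "0 \<le> 1 - y + y\<^sup>2" by simp
  qed (use exp_ge_add_one_self[of y] in simp)
  finally show ?thesis by (simp add: exp_minus field_simps)
qed

locale ratcheting_problem = standard_brownian_motion M W
  for M :: "'a measure" and W :: "real \<Rightarrow> 'a \<Rightarrow> real" +
  fixes \<mu> \<sigma> r cbar :: real
  assumes \<sigma>_pos: "\<sigma> > 0" and r_pos: "r > 0"
    and cbar_nonneg: "0 \<le> cbar" and cbar_le: "cbar \<le> \<mu>"
    and small: "2 * \<mu> * cbar \<le> \<sigma>\<^sup>2 * r"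
begin

abbreviation \<gamma> :: real where "\<gamma> \<equiv> gamma_exponent \<mu> \<sigma> r cbar"

lemma \<gamma>_pos: "\<gamma> > 0"
  unfolding gamma_exponent_def using cbar_le \<sigma>_pos r_pos
  by (intro divide_pos_pos add_nonneg_pos) (auto intro: add_nonneg_pos)

text \<open>The characteristic equation of the generator at rate \<open>cbar\<close>, killed at rate
  \<open>r\<close>: \<open>exp (- \<gamma> * x)\<close> is annihilated by it, so
  \<open>exp (- r * t - \<gamma> * X\<^sub>t)\<close> has no drift.\<close>

lemma \<gamma>_root: "\<sigma>\<^sup>2 * \<gamma>\<^sup>2 = 2 * (\<mu> - cbar) * \<gamma> + 2 * r"
proof -
  define m where "m = \<mu> - cbar"
  define s where "s = sqrt (m\<^sup>2 + 2 * \<sigma>\<^sup>2 * r)"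
  have s: "s\<^sup>2 = m\<^sup>2 + 2 * \<sigma>\<^sup>2 * r" unfolding s_def using r_pos by simp
  have "\<sigma>\<^sup>2 \<noteq> 0" using \<sigma>_pos by simp
  have g: "\<sigma>\<^sup>2 * \<gamma> = m + s"
    using \<sigma>_pos by (simp add: gamma_exponent_def m_def s_def)
  have "\<sigma>\<^sup>2 * (\<sigma>\<^sup>2 * \<gamma>\<^sup>2) = (\<sigma>\<^sup>2 * \<gamma>)\<^sup>2" by (simp add: power2_eq_square)
  also have "\<dots> = 2 * m * (m + s) + 2 * \<sigma>\<^sup>2 * r"
    unfolding g using s by (simp add: power2_eq_square algebra_simps)
  also have "\<dots> = \<sigma>\<^sup>2 * (2 * m * \<gamma> + 2 * r)" unfolding g[symmetric] by (simp add: algebra_simps)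
  finally show ?thesis using \<open>\<sigma>\<^sup>2 \<noteq> 0\<close> unfolding m_def by (metis mult_left_cancel)
qed

text \<open>This is \<open>g'(0) \<le> 1\<close>, the only place where the smallness condition enters.\<close>

lemma \<gamma>_cbar_le: "\<gamma> * cbar \<le> r"
proof (rule ccontr)
  define y where "y = \<gamma> * cbar"
  assume "\<not> \<gamma> * cbar \<le> r"
  then have y: "y > r" by (simp add: y_def)
  have "\<sigma>\<^sup>2 * y\<^sup>2 = (\<sigma>\<^sup>2 * \<gamma>\<^sup>2) * cbar\<^sup>2" by (simp add: y_def power_mult_distrib)
  also have "\<dots> = 2 * (\<mu> - cbar) * cbar * y + 2 * r * cbar\<^sup>2"
    unfolding \<gamma>_root by (simp add: y_def algebra_simps power2_eq_square)
  \<comment> \<open>For \<open>y > r\<close> the last term only lowers the right side, while the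
    smallness condition gives \<open>2 * \<mu> * cbar * y \<le> \<sigma>\<^sup>2 * r * y <
    \<sigma>\<^sup>2 * y\<^sup>2\<close>, a contradiction.\<close>
  finally have eq: "\<sigma>\<^sup>2 * y\<^sup>2 = 2 * \<mu> * cbar * y - 2 * cbar\<^sup>2 * (y - r)"
    by (simp add: algebra_simps power2_eq_square)
  have "2 * \<mu> * cbar * y \<le> \<sigma>\<^sup>2 * r * y" using small y r_pos by (intro mult_right_mono) auto
  also have "\<dots> < \<sigma>\<^sup>2 * y * y" using y \<sigma>_pos r_pos by simp
  finally have "2 * \<mu> * cbar * y < \<sigma>\<^sup>2 * y\<^sup>2" by (simp add: power2_eq_square)
  moreover have "0 \<le> 2 * cbar\<^sup>2 * (y - r)" using y by simp
  ultimately show False using eq by linarith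
qed

text \<open>The HJB inequality in discrete form. Here \<open>q\<close> stands for
  \<open>exp (- \<gamma> * (y + \<delta>))\<close> at surplus \<open>y\<close>, and the first
  summand is the discounted mean of the shifted \<open>g\<close> after one cell at rate
  \<open>d\<close>. Paying \<open>d\<close> instead of \<open>cbar\<close> gains at most
  \<open>\<gamma> * cbar / r * (cbar - d) * h\<close> in this mean and loses
  \<open>(cbar - d) * h\<close> in dividends, so \<open>\<gamma> * cbar \<le> r\<close> makes it
  unprofitable up to second order in \<open>h\<close>.\<close>

lemma one_step_bound:
  assumes "0 \<le> q" "q \<le> 1" "0 \<le> d" "d \<le> cbar" "0 < h"
  shows "exp (- r * h) * (cbar / r * (1 - q * exp ((r - \<gamma> * (cbar - d)) * h))) + h * d
    \<le> cbar / r * (1 - q) + cbar * r * h\<^sup>2"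
proof -
  define u where "u = \<gamma> * (cbar - d) * h"
  have u: "0 \<le> u" using assms \<gamma>_pos by (simp add: u_def)
  have cr: "0 \<le> cbar / r" using cbar_nonneg r_pos by simp
  have e: "exp (- r * h) * exp ((r - \<gamma> * (cbar - d)) * h) = exp (- u)"
    unfolding exp_add[symmetric] u_def by (simp add: algebra_simps)
  have "exp (- r * h) * (cbar / r * (1 - q * exp ((r - \<gamma> * (cbar - d)) * h)))
      = cbar / r * (exp (- r * h) - q * (exp (- r * h) * exp ((r - \<gamma> * (cbar - d)) * h)))"
    by (simp add: algebra_simps)
  also have "\<dots> = cbar / r * (exp (- (r * h)) - q * exp (- u))" unfolding e by simp
  also have "\<dots> \<le> cbar / r * ((1 - r * h + (r * h)\<^sup>2) - q + u)"
  proof (rule mult_left_mono[OF _ cr])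
    have "1 - u \<le> exp (- u)" using exp_ge_add_one_self[of "- u"] by simp
    then have "q * (1 - u) \<le> q * exp (- u)" using assms by (intro mult_left_mono) auto
    moreover have "q * u \<le> u" using assms u by (simp add: mult_left_le_one_le)
    ultimately have "q - u \<le> q * exp (- u)" by (simp add: algebra_simps)
    then show "exp (- (r * h)) - q * exp (- u) \<le> 1 - r * h + (r * h)\<^sup>2 - q + u"
      using exp_minus_le_quadratic[of "r * h"] r_pos assms by simp
  qed
  also have "\<dots> = cbar / r * (1 - q) - cbar * h + cbar * r * h\<^sup>2 + cbar / r * u"
    using r_pos by (simp add: field_simps power2_eq_square)
  also have "cbar / r * u \<le> (cbar - d) * h"
  proof -
    have "cbar / r * u = (\<gamma> * cbar / r) * ((cbar - d) * h)" by (simp add: u_def)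
    also have "\<dots> \<le> 1 * ((cbar - d) * h)"
      using \<gamma>_cbar_le r_pos assms by (intro mult_right_mono) auto
    finally show ?thesis by simp
  qed
  finally show ?thesis by (simp add: algebra_simps)
qed

end

section \<open>The surplus with frozen rates, observed on a grid\<close>

locale grid_walk = ratcheting_problem M W \<mu> \<sigma> r cbar
  for M :: "'a measure" and W \<mu> \<sigma> r cbar +
  fixes D :: "real \<Rightarrow> 'a \<Rightarrow> real" and h x :: real
  assumes h_pos: "h > 0" and D: "D \<in> ratcheting_strategies M W cbar 0"
begin

text \<open>The surplus at time \<open>k * h\<close> if the rate is frozen on each grid cell; since \<open>D\<close> is
  non-decreasing, it dominates the true surplus.\<close>

definition walk :: "nat \<Rightarrow> 'a \<Rightarrow> real" where
  "walk k \<omega> = x + h * (\<Sum>j<k. \<mu> - D (real j * h) \<omega>) + \<sigma> * W (real k * h) \<omega>"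

text \<open>Real-valued so that it can multiply integrands. The level \<open>a\<close> is 0 for the
  upper bound on all strategies and positive for the lower bound at the constant rate.\<close>

definition alive :: "real \<Rightarrow> nat \<Rightarrow> 'a \<Rightarrow> real" where
  "alive a k \<omega> = of_bool (\<forall>j\<le>k. a < walk j \<omega>)"

abbreviation incr :: "nat \<Rightarrow> 'a \<Rightarrow> real" where
  "incr k \<omega> \<equiv> W (real (Suc k) * h) \<omega> - W (real k * h) \<omega>"

lemma rate_bounds:
  assumes "\<omega> \<in> space M" "0 \<le> t"
  shows "0 \<le> D t \<omega>" "D t \<omega> \<le> cbar"
  using D assms by (auto simp: ratcheting_strategies_def)

lemma rate_measurable:
  "0 \<le> t \<Longrightarrow> D t \<in> borel_measurable (augmented_filtration M W t)"
  using D by (auto simp: ratcheting_strategies_def)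

lemma grid_nonneg[simp]: "0 \<le> real k * h"
  using h_pos by simp

lemma walk_adapted: "walk k \<in> borel_measurable (augmented_filtration M W (real k * h))"
proof -
  have "(\<lambda>\<omega>. \<Sum>j<k. \<mu> - D (real j * h) \<omega>) \<in> borel_measurable (augmented_filtration M W (real k * h))"
  proof (rule borel_measurable_sum)
    fix j assume "j \<in> {..<k}"
    then have "real j * h \<le> real k * h" using h_pos by simp
    then have "D (real j * h) \<in> borel_measurable (augmented_filtration M W (real k * h))"
      using rate_measurable[of "real j * h"] by (auto intro: measurable_augmented_mono)
    then show "(\<lambda>\<omega>. \<mu> - D (real j * h) \<omega>) \<in> borel_measurable (augmented_filtration M W (real k * h))"
      by simp
  qed
  then show ?thesis
    unfolding walk_def[abs_def] using process_measurable_augmented[of "real k * h" W M] by simp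
qed

lemma alive_adapted: "alive a k \<in> borel_measurable (augmented_filtration M W (real k * h))"
proof -
  have w: "walk j \<in> borel_measurable (augmented_filtration M W (real k * h))" if "j \<le> k" for j
    using that h_pos by (intro measurable_augmented_mono[OF walk_adapted]) (simp add: mult_right_mono)
  have "Measurable.pred (augmented_filtration M W (real k * h)) (\<lambda>\<omega>. \<forall>j\<in>{..k}. a < walk j \<omega>)"
  proof (rule pred_intros_finite(3))
    fix j assume "j \<in> {..k}"
    then have [measurable]: "walk j \<in> borel_measurable (augmented_filtration M W (real k * h))" using w by simp
    show "Measurable.pred (augmented_filtration M W (real k * h)) (\<lambda>\<omega>. a < walk j \<omega>)" by measurable
  qed simp
  then have "{\<omega> \<in> space (augmented_filtration M W (real k * h)). \<forall>j\<in>{..k}. a < walk j \<omega>}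
      \<in> sets (augmented_filtration M W (real k * h))"
    by (simp only: pred_def)
  then have "(indicator {\<omega> \<in> space (augmented_filtration M W (real k * h)). \<forall>j\<in>{..k}. a < walk j \<omega>} :: 'a \<Rightarrow> real)
      \<in> borel_measurable (augmented_filtration M W (real k * h))"
    by (rule borel_measurable_indicator)
  then show ?thesis
    by (rule measurable_cong[THEN iffD1, rotated]) (auto simp: alive_def indicator_def)
qed

lemmas [measurable] = measurable_augmented[OF walk_adapted] measurable_augmented[OF alive_adapted]

lemma rate_measurable_M[measurable]: "D (real k * h) \<in> borel_measurable M"
  by (intro measurable_augmented[OF rate_measurable]) simp

lemma alive_01[simp]: "0 \<le> alive a k \<omega>" "alive a k \<omega> \<le> 1"
  by (auto simp: alive_def)

lemma alive_Suc: "alive a (Suc k) \<omega> = alive a k \<omega> * of_bool (a < walk (Suc k) \<omega>)"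
  by (auto simp: alive_def le_Suc_eq)

lemma alive_cases:
  obtains "alive a k \<omega> = 0" | "alive a k \<omega> = 1" "a < walk k \<omega>"
  by (cases "\<forall>j\<le>k. a < walk j \<omega>") (auto simp: alive_def)

lemma walk_0: "AE \<omega> in M. walk 0 \<omega> = x"
  using start_0 by eventually_elim (simp add: walk_def)

lemma walk_Suc: "walk (Suc k) \<omega> = walk k \<omega> + h * (\<mu> - D (real k * h) \<omega>) + \<sigma> * incr k \<omega>"
  by (simp add: walk_def algebra_simps)

text \<open>The bound is asked for only above the level \<open>a\<close>, since \<open>alive\<close>
  vanishes elsewhere: functions such as \<open>exp (- \<gamma> * walk k \<omega>)\<close> are
  bounded there but not globally.\<close>

lemma integrable_alive_mult:
  assumes [measurable]: "f \<in> borel_measurable M"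
    and "\<And>\<omega>. \<omega> \<in> space M \<Longrightarrow> a < walk k \<omega> \<Longrightarrow> \<bar>f \<omega>\<bar> \<le> B"
  shows "integrable M (\<lambda>\<omega>. alive a k \<omega> * f \<omega>)"
\<comment> \<open>If the walk is nowhere above \<open>a\<close>, the assumption leaves the sign of
  \<open>B\<close> open.\<close>
proof (rule integrable_const_bound[where B="max B 0"])
  show "AE \<omega> in M. norm (alive a k \<omega> * f \<omega>) \<le> max B 0"
  proof (rule AE_I2)
    fix \<omega> assume "\<omega> \<in> space M"
    then show "norm (alive a k \<omega> * f \<omega>) \<le> max B 0"
      using assms(2)[of \<omega>] by (cases rule: alive_cases[of a k \<omega>]) auto
  qed
qed measurable

text \<open>The Gaussian increment contributes the exponent
  \<open>\<gamma>\<^sup>2 * \<sigma>\<^sup>2 * h / 2\<close>, which \<open>\<gamma>_root\<close>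
  turns into \<open>((\<mu> - cbar) * \<gamma> + r) * h\<close>. Adding the drift part leaves
  \<open>(r - \<gamma> * (cbar - D)) * h\<close>, which is exactly \<open>r * h\<close> at the full
  rate.\<close>

lemma one_step_expectation:
  assumes "0 \<le> a"
  shows "has_bochner_integral M (\<lambda>\<omega>. alive a k \<omega> * exp (- \<gamma> * walk (Suc k) \<omega>))
    (expectation (\<lambda>\<omega>. alive a k \<omega> * (exp (- \<gamma> * walk k \<omega>) * exp ((r - \<gamma> * (cbar - D (real k * h) \<omega>)) * h))))"
proof -
  let ?s = "real k * h" and ?t = "real (Suc k) * h"
  let ?F = "augmented_filtration M W ?s"
  define U where "U = (\<lambda>\<omega>. alive a k \<omega> * (exp (- \<gamma> * walk k \<omega>) * exp (- \<gamma> * (h * (\<mu> - D ?s \<omega>)))))"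
  have st: "?t - ?s = h" by (simp add: algebra_simps)
  have "?s < ?t" using h_pos by (simp add: algebra_simps)
  have U: "U \<in> borel_measurable ?F"
    unfolding U_def using walk_adapted[of k] alive_adapted[of a k] rate_measurable[of ?s] by simp
  have intU: "integrable M U"
    unfolding U_def
  proof (rule integrable_alive_mult[where B=1])
    fix \<omega> assume \<omega>: "\<omega> \<in> space M" "a < walk k \<omega>"
    have "0 \<le> \<mu> - D ?s \<omega>" using rate_bounds[OF \<omega>(1), of ?s] cbar_le by simp
    then have "exp (- \<gamma> * walk k \<omega>) * exp (- \<gamma> * (h * (\<mu> - D ?s \<omega>))) \<le> 1 * 1"
      using \<gamma>_pos h_pos \<omega>(2) assms by (intro mult_mono) auto
    then show "\<bar>exp (- \<gamma> * walk k \<omega>) * exp (- \<gamma> * (h * (\<mu> - D ?s \<omega>)))\<bar> \<le> 1" by simp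
  qed measurable
  have "has_bochner_integral M (\<lambda>\<omega>. U \<omega> * exp ((- \<gamma> * \<sigma>) * incr k \<omega>))
      (expectation U * exp ((- \<gamma> * \<sigma>)\<^sup>2 * (?t - ?s) / 2))"
    by (rule expectation_mult_exp_increment[OF _ \<open>?s < ?t\<close> U intU]) simp
  moreover have "U \<omega> * exp ((- \<gamma> * \<sigma>) * incr k \<omega>) = alive a k \<omega> * exp (- \<gamma> * walk (Suc k) \<omega>)" for \<omega>
  proof -
    have e: "- \<gamma> * walk (Suc k) \<omega> = - \<gamma> * walk k \<omega> + - \<gamma> * (h * (\<mu> - D ?s \<omega>)) + (- \<gamma> * \<sigma>) * incr k \<omega>"
      unfolding walk_Suc by (simp add: algebra_simps)
    show ?thesis unfolding e U_def exp_add by (simp only: mult.assoc)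
  qed
  moreover have "expectation U * exp ((- \<gamma> * \<sigma>)\<^sup>2 * (?t - ?s) / 2) =
      expectation (\<lambda>\<omega>. alive a k \<omega> * (exp (- \<gamma> * walk k \<omega>) * exp ((r - \<gamma> * (cbar - D ?s \<omega>)) * h)))"
  proof -
    have c: "(- \<gamma> * \<sigma>)\<^sup>2 * (?t - ?s) / 2 = ((\<mu> - cbar) * \<gamma> + r) * h"
      using \<gamma>_root unfolding st by (simp add: power_mult_distrib mult.commute)
    have "U \<omega> * exp (((\<mu> - cbar) * \<gamma> + r) * h) =
        alive a k \<omega> * (exp (- \<gamma> * walk k \<omega>) * exp ((r - \<gamma> * (cbar - D ?s \<omega>)) * h))" for \<omega>
    proof -
      have e: "(r - \<gamma> * (cbar - D ?s \<omega>)) * h = - \<gamma> * (h * (\<mu> - D ?s \<omega>)) + ((\<mu> - cbar) * \<gamma> + r) * h"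
        by (simp add: algebra_simps)
      show ?thesis unfolding e U_def exp_add by (simp only: mult.assoc)
    qed
    moreover have "expectation U * exp (((\<mu> - cbar) * \<gamma> + r) * h) =
        expectation (\<lambda>\<omega>. U \<omega> * exp (((\<mu> - cbar) * \<gamma> + r) * h))"
      by simp
    ultimately show ?thesis unfolding c by (simp only:)
  qed
  ultimately show ?thesis by simp
qed

section \<open>The supermartingale inequality for the shifted value function\<close>

context
  fixes \<delta> L :: real
  assumes \<delta>: "0 < \<delta>" and L: "1 \<le> L"
begin

text \<open>\<open>g\<close> shifted by \<open>\<delta>\<close>: an overshoot below zero stays harmless up to size \<open>\<delta>\<close>, and larger
  overshoots are exponentially unlikely.\<close>

private definition G :: "real \<Rightarrow> real" where
  "G y = cbar / r * (1 - exp (- \<gamma> * (y + \<delta>)))"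

text \<open>A Chernoff-type bound. With \<open>L = n\<close> and \<open>h = 1 / n\<^sup>2\<close>
  the first exponential becomes negligible while the mean of the second stays constant.\<close>

private definition overshoot :: "nat \<Rightarrow> 'a \<Rightarrow> real" where
  "overshoot k \<omega> = cbar / r * (exp (- (L * \<gamma> * \<delta>)) * exp ((- (L * \<gamma> * \<sigma>)) * incr k \<omega>))"

text \<open>The total error of one step: the second-order term of \<open>one_step_bound\<close> plus
  the mean overshoot.\<close>

private definition \<eta> :: real where
  "\<eta> = cbar * r * h\<^sup>2 + cbar / r * (exp (- (L * \<gamma> * \<delta>)) * exp ((L * \<gamma> * \<sigma>)\<^sup>2 * h / 2))"

private lemma overshoot_integral:
  "has_bochner_integral M (overshoot k) (cbar / r * (exp (- (L * \<gamma> * \<delta>)) * exp ((L * \<gamma> * \<sigma>)\<^sup>2 * h / 2)))"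
proof -
  have "real k * h < real (Suc k) * h" using h_pos by simp
  then have "has_bochner_integral M (\<lambda>\<omega>. exp ((- (L * \<gamma> * \<sigma>)) * incr k \<omega>))
      (exp ((- (L * \<gamma> * \<sigma>))\<^sup>2 * (real (Suc k) * h - real k * h) / 2))"
    by (rule increment_exp_moment[OF grid_nonneg])
  moreover have "(- (L * \<gamma> * \<sigma>))\<^sup>2 * (real (Suc k) * h - real k * h) / 2 = (L * \<gamma> * \<sigma>)\<^sup>2 * h / 2"
    by (simp add: algebra_simps)
  ultimately have "has_bochner_integral M (\<lambda>\<omega>. exp ((- (L * \<gamma> * \<sigma>)) * incr k \<omega>)) (exp ((L * \<gamma> * \<sigma>)\<^sup>2 * h / 2))"
    by (simp only:)
  then show ?thesis
    unfolding overshoot_def[abs_def] by (intro has_bochner_integral_mult_right)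
qed

private lemma G_measurable[measurable]: "G \<in> borel_measurable borel"
  unfolding G_def[abs_def] by measurable

private lemma G_bounds: "0 < y \<Longrightarrow> 0 \<le> G y \<and> G y \<le> cbar / r"
  unfolding G_def using \<gamma>_pos \<delta> cbar_nonneg r_pos
  by (intro conjI mult_nonneg_nonneg mult_left_le) auto

text \<open>Killing the walk matters only when it crosses zero in this step. It then started above
  zero and its drift is nonnegative, so a very negative \<open>G\<close> requires a very negative
  increment.\<close>

private lemma G_Suc_le:
  assumes "\<omega> \<in> space M"
  shows "alive 0 (Suc k) \<omega> * G (walk (Suc k) \<omega>) \<le> alive 0 k \<omega> * G (walk (Suc k) \<omega>) + overshoot k \<omega>"
proof (cases rule: alive_cases[of 0 k \<omega>])
  case 1
  then show ?thesis using cbar_nonneg r_pos by (simp add: alive_Suc overshoot_def)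
next
  case 2
  show ?thesis
  proof (cases "0 < walk (Suc k) \<omega>")
    case True
    then show ?thesis using 2 cbar_nonneg r_pos by (simp add: alive_Suc overshoot_def)
  next
    case False
    define u where "u = - \<gamma> * (\<sigma> * incr k \<omega> + \<delta>)"
    have "0 \<le> h * (\<mu> - D (real k * h) \<omega>)"
      using rate_bounds[OF assms, of "real k * h"] cbar_le h_pos by simp
    then have "\<sigma> * incr k \<omega> + \<delta> \<le> walk (Suc k) \<omega> + \<delta>"
      using 2 unfolding walk_Suc by simp
    then have "- \<gamma> * (walk (Suc k) \<omega> + \<delta>) \<le> u"
      unfolding u_def using \<gamma>_pos by simp
    then have *: "exp (- \<gamma> * (walk (Suc k) \<omega> + \<delta>)) \<le> exp u" by simp
    \<comment> \<open>The summand 1 cancels the constant in \<open>G\<close>; what remains,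
      \<open>exp (L * u)\<close>, is the overshoot bound.\<close>
    have "exp u \<le> 1 + exp (L * u)"
    proof (cases "u \<le> 0")
      case True
      then have "exp u \<le> 1" by simp
      then show ?thesis using exp_gt_zero[of "L * u"] by linarith
    next
      case False
      then have "u \<le> L * u" using L by simp
      then have "exp u \<le> exp (L * u)" by simp
      then show ?thesis by linarith
    qed
    with * have "0 \<le> 1 - exp (- \<gamma> * (walk (Suc k) \<omega> + \<delta>)) + exp (L * u)" by linarith
    then have "0 \<le> cbar / r * (1 - exp (- \<gamma> * (walk (Suc k) \<omega> + \<delta>)) + exp (L * u))"
      using cbar_nonneg r_pos by simp
    also have "\<dots> = G (walk (Suc k) \<omega>) + cbar / r * exp (L * u)"
      by (simp add: G_def algebra_simps)
    also have "exp (L * u) = exp (- (L * \<gamma> * \<delta>)) * exp ((- (L * \<gamma> * \<sigma>)) * incr k \<omega>)"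
      unfolding exp_add[symmetric] u_def by (simp add: algebra_simps)
    finally show ?thesis using False 2 by (simp add: alive_Suc overshoot_def)
  qed
qed

text \<open>First drop the killing at the cost of the overshoot, then average over the increment,
  and finally apply \<open>one_step_bound\<close> for each outcome.\<close>

private lemma supermartingale_step:
  "exp (- r * h) * expectation (\<lambda>\<omega>. alive 0 (Suc k) \<omega> * G (walk (Suc k) \<omega>))
    + expectation (\<lambda>\<omega>. alive 0 k \<omega> * (h * D (real k * h) \<omega>))
    \<le> expectation (\<lambda>\<omega>. alive 0 k \<omega> * G (walk k \<omega>)) + \<eta>"
proof -
  let ?d = "\<lambda>\<omega>. D (real k * h) \<omega>"
  define q where "q = (\<lambda>\<omega>. exp (- \<gamma> * walk k \<omega>) * exp (- \<gamma> * \<delta>))"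
  \<comment> \<open>\<open>H\<close> plays the role of the conditional expectation of
    \<open>G (walk (Suc k) \<omega>)\<close> given the past at time \<open>k * h\<close>.\<close>
  define H where "H = (\<lambda>\<omega>. cbar / r * (1 - q \<omega> * exp ((r - \<gamma> * (cbar - ?d \<omega>)) * h)))"
  have [measurable]: "q \<in> borel_measurable M" "H \<in> borel_measurable M"
    unfolding q_def H_def by measurable
  have q01: "0 \<le> q \<omega>" "q \<omega> \<le> 1" if "0 < walk k \<omega>" for \<omega>
    unfolding q_def using that \<gamma>_pos \<delta> mult_mono[of "exp (- \<gamma> * walk k \<omega>)" 1 "exp (- \<gamma> * \<delta>)" 1] by auto
  have e_bd: "exp ((r - \<gamma> * (cbar - ?d \<omega>)) * h) \<le> exp (r * h)" if "\<omega> \<in> space M" for \<omega>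
    using rate_bounds[OF that, of "real k * h"] \<gamma>_pos h_pos by simp
  have intP: "integrable M (alive 0 k)"
    using integrable_alive_mult[of "\<lambda>_. 1" 0 k 1] by simp
  have intE: "integrable M (\<lambda>\<omega>. alive 0 k \<omega> * (exp (- \<gamma> * walk k \<omega>) * exp ((r - \<gamma> * (cbar - ?d \<omega>)) * h)))"
  proof (rule integrable_alive_mult[where B="1 * exp (r * h)"])
    fix \<omega> assume \<omega>: "\<omega> \<in> space M" "0 < walk k \<omega>"
    have "exp (- \<gamma> * walk k \<omega>) * exp ((r - \<gamma> * (cbar - ?d \<omega>)) * h) \<le> 1 * exp (r * h)"
      by (rule mult_mono) (use e_bd[OF \<omega>(1)] \<omega>(2) \<gamma>_pos in auto)
    then show "\<bar>exp (- \<gamma> * walk k \<omega>) * exp ((r - \<gamma> * (cbar - ?d \<omega>)) * h)\<bar> \<le> 1 * exp (r * h)" by simp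
  qed measurable
  have G_Suc_eq: "alive 0 k \<omega> * G (walk (Suc k) \<omega>) =
      cbar / r * (alive 0 k \<omega> - exp (- \<gamma> * \<delta>) * (alive 0 k \<omega> * exp (- \<gamma> * walk (Suc k) \<omega>)))" for \<omega>
    unfolding G_def by (simp add: distrib_left exp_add[symmetric] algebra_simps flip: exp_add)
  have H_eq: "alive 0 k \<omega> * H \<omega> = cbar / r * (alive 0 k \<omega> - exp (- \<gamma> * \<delta>) *
      (alive 0 k \<omega> * (exp (- \<gamma> * walk k \<omega>) * exp ((r - \<gamma> * (cbar - ?d \<omega>)) * h))))" for \<omega>
    unfolding H_def q_def by (simp add: algebra_simps)
  note os = one_step_expectation[of 0 k, unfolded has_bochner_integral_iff, simplified order_refl]
  have intH: "integrable M (\<lambda>\<omega>. alive 0 k \<omega> * H \<omega>)"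
    unfolding H_eq by (intro integrable_mult_right Bochner_Integration.integrable_diff intP intE)
  have intGS: "integrable M (\<lambda>\<omega>. alive 0 k \<omega> * G (walk (Suc k) \<omega>))"
    unfolding G_Suc_eq using os by (intro integrable_mult_right Bochner_Integration.integrable_diff intP) auto
  have EG: "expectation (\<lambda>\<omega>. alive 0 k \<omega> * G (walk (Suc k) \<omega>)) = expectation (\<lambda>\<omega>. alive 0 k \<omega> * H \<omega>)"
    unfolding H_eq G_Suc_eq using os intP intE
    by (simp add: Bochner_Integration.integral_diff)
  have intG: "integrable M (\<lambda>\<omega>. alive 0 j \<omega> * G (walk j \<omega>))" for j
  proof (rule integrable_alive_mult[where B="cbar / r"])
    show "\<bar>G (walk j \<omega>)\<bar> \<le> cbar / r" if "0 < walk j \<omega>" for \<omega>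
      using G_bounds[OF that] by simp
  qed measurable
  have intD: "integrable M (\<lambda>\<omega>. alive 0 k \<omega> * (h * ?d \<omega>))"
  proof (rule integrable_alive_mult[where B="h * cbar"])
    fix \<omega> assume \<omega>: "\<omega> \<in> space M"
    show "\<bar>h * ?d \<omega>\<bar> \<le> h * cbar"
      using rate_bounds[OF \<omega>, of "real k * h"] h_pos by (simp add: abs_mult)
  qed measurable
  note ov = overshoot_integral[of k, unfolded has_bochner_integral_iff]
  have "expectation (\<lambda>\<omega>. alive 0 (Suc k) \<omega> * G (walk (Suc k) \<omega>)) \<le>
      expectation (\<lambda>\<omega>. alive 0 k \<omega> * G (walk (Suc k) \<omega>) + overshoot k \<omega>)"
    using ov G_Suc_le by (intro integral_mono intG Bochner_Integration.integrable_add intGS) auto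
  also have "\<dots> = expectation (\<lambda>\<omega>. alive 0 k \<omega> * H \<omega>) + expectation (overshoot k)"
    using ov intGS EG by simp
  finally have 1: "expectation (\<lambda>\<omega>. alive 0 (Suc k) \<omega> * G (walk (Suc k) \<omega>)) \<le>
      expectation (\<lambda>\<omega>. alive 0 k \<omega> * H \<omega>) + expectation (overshoot k)" .
  have ov0: "0 \<le> expectation (overshoot k)"
    using ov cbar_nonneg r_pos by simp
  have "exp (- r * h) * expectation (\<lambda>\<omega>. alive 0 (Suc k) \<omega> * G (walk (Suc k) \<omega>)) \<le>
     exp (- r * h) * expectation (\<lambda>\<omega>. alive 0 k \<omega> * H \<omega>) + exp (- r * h) * expectation (overshoot k)"
    using 1 by (simp add: distrib_left[symmetric])
  also have "exp (- r * h) * expectation (overshoot k) \<le> expectation (overshoot k)"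
    using ov0 r_pos h_pos by (intro mult_left_le_one_le) auto
  finally have 2: "exp (- r * h) * expectation (\<lambda>\<omega>. alive 0 (Suc k) \<omega> * G (walk (Suc k) \<omega>)) \<le>
     exp (- r * h) * expectation (\<lambda>\<omega>. alive 0 k \<omega> * H \<omega>) + expectation (overshoot k)" by simp
  have "exp (- r * h) * expectation (\<lambda>\<omega>. alive 0 k \<omega> * H \<omega>) + expectation (\<lambda>\<omega>. alive 0 k \<omega> * (h * ?d \<omega>))
      = expectation (\<lambda>\<omega>. exp (- r * h) * (alive 0 k \<omega> * H \<omega>) + alive 0 k \<omega> * (h * ?d \<omega>))"
    using intH intD by simp
  also have "\<dots> \<le> expectation (\<lambda>\<omega>. alive 0 k \<omega> * G (walk k \<omega>) + cbar * r * h\<^sup>2)"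
  proof (intro integral_mono Bochner_Integration.integrable_add integrable_mult_right intH intD intG)
    fix \<omega> assume \<omega>: "\<omega> \<in> space M"
    show "exp (- r * h) * (alive 0 k \<omega> * H \<omega>) + alive 0 k \<omega> * (h * ?d \<omega>)
      \<le> alive 0 k \<omega> * G (walk k \<omega>) + cbar * r * h\<^sup>2"
    proof (cases rule: alive_cases[of 0 k \<omega>])
      case 1
      then show ?thesis using cbar_nonneg r_pos by simp
    next
      case 2
      have "G (walk k \<omega>) = cbar / r * (1 - q \<omega>)"
        unfolding G_def q_def by (simp add: distrib_left flip: exp_add)
      then show ?thesis
        using one_step_bound[of "q \<omega>" "?d \<omega>" h] q01[OF 2(2)] 2(1) rate_bounds[OF \<omega>, of "real k * h"] h_pos
        by (simp add: H_def)
    qed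
  qed auto
  also have "\<dots> = expectation (\<lambda>\<omega>. alive 0 k \<omega> * G (walk k \<omega>)) + cbar * r * h\<^sup>2"
    using intG by (simp add: prob_space)
  finally show ?thesis using 2 ov unfolding \<eta>_def by linarith
qed

private lemma expected_payments_induct:
  "(\<Sum>k<K. exp (- r * (real k * h)) * expectation (\<lambda>\<omega>. alive 0 k \<omega> * (h * D (real k * h) \<omega>)))
    + exp (- r * (real K * h)) * expectation (\<lambda>\<omega>. alive 0 K \<omega> * G (walk K \<omega>))
    \<le> expectation (\<lambda>\<omega>. alive 0 0 \<omega> * G (walk 0 \<omega>)) + (\<Sum>k<K. exp (- r * (real k * h)) * \<eta>)"
proof (induction K)
  case (Suc K)
  let ?e = "exp (- r * (real K * h))"
  have e: "exp (- r * (real (Suc K) * h)) = ?e * exp (- r * h)"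
    unfolding exp_add[symmetric] by (simp add: algebra_simps)
  have "?e * (exp (- r * h) * expectation (\<lambda>\<omega>. alive 0 (Suc K) \<omega> * G (walk (Suc K) \<omega>))
    + expectation (\<lambda>\<omega>. alive 0 K \<omega> * (h * D (real K * h) \<omega>)))
    \<le> ?e * (expectation (\<lambda>\<omega>. alive 0 K \<omega> * G (walk K \<omega>)) + \<eta>)"
    by (rule mult_left_mono[OF supermartingale_step]) simp
  then show ?case using Suc unfolding e sum.lessThan_Suc by (simp only: distrib_left mult.assoc)
qed simp

lemma expected_payments_le:
  assumes "0 \<le> x"
  shows "(\<Sum>k<K. exp (- r * (real k * h)) * expectation (\<lambda>\<omega>. alive 0 k \<omega> * (h * D (real k * h) \<omega>)))
    \<le> cbar / r * (1 - exp (- \<gamma> * (x + \<delta>))) + (1 + r * h) / (r * h) *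
      (cbar * r * h\<^sup>2 + cbar / r * (exp (- (L * \<gamma> * \<delta>)) * exp ((L * \<gamma> * \<sigma>)\<^sup>2 * h / 2)))"
proof -
  have \<eta>: "0 \<le> \<eta>" unfolding \<eta>_def using cbar_nonneg r_pos by simp
  have Gx: "0 \<le> G x"
    unfolding G_def using assms \<gamma>_pos \<delta> cbar_nonneg r_pos by (auto intro!: mult_nonneg_nonneg)
  have "0 \<le> expectation (\<lambda>\<omega>. alive 0 K \<omega> * G (walk K \<omega>))"
  proof (rule integral_nonneg_AE, rule AE_I2)
    fix \<omega>
    show "0 \<le> alive 0 K \<omega> * G (walk K \<omega>)"
      by (cases rule: alive_cases[of 0 K \<omega>]) (use G_bounds in auto)
  qed
  then have K: "0 \<le> exp (- r * (real K * h)) * expectation (\<lambda>\<omega>. alive 0 K \<omega> * G (walk K \<omega>))" by simp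
  have "expectation (\<lambda>\<omega>. alive 0 0 \<omega> * G (walk 0 \<omega>)) \<le> expectation (\<lambda>\<omega>. G x)"
  proof (rule integral_mono_AE')
    show "AE \<omega> in M. alive 0 0 \<omega> * G (walk 0 \<omega>) \<le> G x"
      using walk_0
    proof eventually_elim
      case (elim \<omega>)
      then show ?case using Gx by (cases rule: alive_cases[of 0 0 \<omega>]) auto
    qed
  qed (use Gx in auto)
  then have 0: "expectation (\<lambda>\<omega>. alive 0 0 \<omega> * G (walk 0 \<omega>)) \<le> G x" by (simp add: prob_space)
  \<comment> \<open>A geometric series bounded independently of \<open>K\<close>. It is of order
    \<open>1 / h\<close>, so the second-order part of \<open>\<eta>\<close> contributes only
    \<open>O(h)\<close> in total.\<close>
  have "(\<Sum>k<K. exp (- r * (real k * h))) \<le> (1 + r * h) / (r * h)"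
  proof -
    let ?z = "exp (- (r * h))"
    have rh: "0 < r * h" using r_pos h_pos by simp
    have z: "0 < ?z" "?z < 1" "?z \<noteq> 1" using rh by auto
    have "(\<Sum>k<K. exp (- r * (real k * h))) = (\<Sum>k<K. ?z ^ k)"
      by (intro sum.cong refl) (simp add: exp_of_nat_mult[symmetric] algebra_simps)
    also have "\<dots> = (1 - ?z ^ K) / (1 - ?z)"
      by (metis geometric_sum[OF z(3)] minus_diff_eq minus_divide_divide)
    also have "\<dots> \<le> 1 / (1 - ?z)" using z by (intro divide_right_mono) auto
    also have "\<dots> \<le> 1 / (1 - 1 / (1 + r * h))"
    proof (rule divide_left_mono)
      have "?z \<le> 1 / (1 + r * h)"
        using exp_ge_add_one_self[of "r * h"] rh by (simp add: exp_minus divide_simps)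
      then show "1 - 1 / (1 + r * h) \<le> 1 - ?z" by simp
      show "0 < (1 - ?z) * (1 - 1 / (1 + r * h))" using z rh by (intro mult_pos_pos) auto
    qed simp
    also have "\<dots> = (1 + r * h) / (r * h)" using rh by (simp add: divide_simps)
    finally show ?thesis .
  qed
  then have "(\<Sum>k<K. exp (- r * (real k * h)) * \<eta>) \<le> (1 + r * h) / (r * h) * \<eta>"
    unfolding sum_distrib_right[symmetric] using \<eta> by (intro mult_right_mono)
  then show ?thesis
    using expected_payments_induct[of K] K 0 unfolding \<eta>_def G_def by linarith
qed

end

section \<open>Discount factors at entrance times on the grid\<close>

text \<open>The discount factor at the first grid time at which the walk is at most \<open>a\<close>, provided this
  happens within \<open>K\<close> steps; \<open>0\<close> otherwise.\<close>

definition hit_discount :: "real \<Rightarrow> nat \<Rightarrow> 'a \<Rightarrow> real" where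
  "hit_discount a K \<omega> = (1 - alive a 0 \<omega>)
    + (\<Sum>k<K. exp (- r * (real (Suc k) * h)) * (alive a k \<omega> - alive a (Suc k) \<omega>))"

lemma alive_Suc_le: "alive a (Suc k) \<omega> \<le> alive a k \<omega>"
  by (auto simp: alive_Suc intro: mult_left_le)

lemma hit_discount_mono:
  assumes "k \<le> K"
  shows "hit_discount a k \<omega> \<le> hit_discount a K \<omega>"
  using assms
proof (rule lift_Suc_mono_le[rotated])
  show "hit_discount a n \<omega> \<le> hit_discount a (Suc n) \<omega>" for n
    using alive_Suc_le[of a n \<omega>] by (simp add: hit_discount_def)
qed

lemma hit_discount_nonneg: "0 \<le> hit_discount a K \<omega>"
  using hit_discount_mono[of 0 K a \<omega>] alive_01(2)[of a 0 \<omega>] by (simp add: hit_discount_def)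

text \<open>An entrance within \<open>K\<close> steps happens no later than \<open>K * h\<close>, so
  its discount factor is at least the one at that time.\<close>

lemma hit_discount_ge_dead:
  "exp (- r * (real K * h)) * (1 - alive a K \<omega>) \<le> hit_discount a K \<omega>"
proof (induction K)
  case (Suc K)
  have "exp (- r * (real (Suc K) * h)) * (1 - alive a (Suc K) \<omega>) =
      exp (- r * (real (Suc K) * h)) * (1 - alive a K \<omega>)
      + exp (- r * (real (Suc K) * h)) * (alive a K \<omega> - alive a (Suc K) \<omega>)"
    by (simp add: algebra_simps)
  also have "exp (- r * (real (Suc K) * h)) * (1 - alive a K \<omega>) \<le> exp (- r * (real K * h)) * (1 - alive a K \<omega>)"
    using r_pos h_pos by (intro mult_right_mono) (auto simp: mult_right_mono)
  finally show ?case using Suc by (simp add: hit_discount_def)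
qed (simp add: hit_discount_def)

lemma hit_discount_ge:
  assumes "k \<le> K" "walk k \<omega> \<le> a" "real k * h \<le> t"
  shows "exp (- r * t) \<le> hit_discount a K \<omega>"
proof -
  have "alive a k \<omega> = 0" using assms(2) by (auto simp: alive_def not_less)
  then have "exp (- r * (real k * h)) \<le> hit_discount a k \<omega>"
    using hit_discount_ge_dead[of k a \<omega>] by simp
  moreover have "exp (- r * t) \<le> exp (- r * (real k * h))" using assms(3) r_pos by simp
  ultimately show ?thesis using hit_discount_mono[OF assms(1), of a \<omega>] by linarith
qed

lemma integrable_alive: "integrable M (alive a k)"
  using integrable_alive_mult[of "\<lambda>_. 1" a k 1] by simp

lemma integrable_hit_discount: "integrable M (hit_discount a K)"
  unfolding hit_discount_def[abs_def] using integrable_alive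
  by (intro Bochner_Integration.integrable_add Bochner_Integration.integrable_sum
      Bochner_Integration.integrable_diff integrable_mult_right) auto

text \<open>Optional stopping, carried out by induction on the number of steps.\<close>

lemma expectation_hit_discount_le:
  assumes "0 \<le> a" "0 \<le> x" and const: "D = (\<lambda>t \<omega>. cbar)"
  shows "expectation (hit_discount a K) \<le> exp (\<gamma> * a - \<gamma> * x)"
proof -
  let ?Z = "\<lambda>k \<omega>. alive a k \<omega> * exp (- \<gamma> * walk k \<omega>)"
  let ?z = "exp (- \<gamma> * a)"
  have intZ: "integrable M (?Z k)" for k
  proof (rule integrable_alive_mult[where B=1])
    show "\<bar>exp (- \<gamma> * walk k \<omega>)\<bar> \<le> 1" if "a < walk k \<omega>" for \<omega>
      using \<gamma>_pos assms(1) that by simp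
  qed measurable
  note intR = integrable_hit_discount[of a]
  \<comment> \<open>The first summand accounts for paths already stopped, valued as if exactly at
    level \<open>a\<close>; the second is the part still running.\<close>
  have "?z * expectation (hit_discount a K) + exp (- r * (real K * h)) * expectation (?Z K) \<le> exp (- \<gamma> * x)"
  proof (induction K)
    case 0
    have "?z * expectation (hit_discount a 0) + expectation (?Z 0)
        = expectation (\<lambda>\<omega>. ?z * hit_discount a 0 \<omega> + ?Z 0 \<omega>)"
      using intR[of 0] intZ[of 0] by simp
    also have "\<dots> \<le> expectation (\<lambda>_. exp (- \<gamma> * x))"
    proof (rule integral_mono_AE)
      show "AE \<omega> in M. ?z * hit_discount a 0 \<omega> + ?Z 0 \<omega> \<le> exp (- \<gamma> * x)"
        using walk_0
      proof eventually_elim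
        case (elim \<omega>)
        then show ?case using \<gamma>_pos by (auto simp: hit_discount_def alive_def)
      qed
    qed (use intR[of 0] intZ[of 0] in auto)
    finally show ?case by (simp add: prob_space)
  next
    case (Suc K)
    let ?e = "exp (- r * (real (Suc K) * h))"
    note os = one_step_expectation[OF assms(1), of K, unfolded has_bochner_integral_iff]
    have pt: "?z * hit_discount a (Suc K) \<omega> + ?e * ?Z (Suc K) \<omega>
      \<le> ?z * hit_discount a K \<omega> + ?e * (alive a K \<omega> * exp (- \<gamma> * walk (Suc K) \<omega>))" for \<omega>
    proof -
      \<comment> \<open>On entrance the walk is at most \<open>a\<close>, so \<open>?z\<close> is at
        most \<open>exp (- \<gamma> * walk (Suc K) \<omega>)\<close>: here an overshoot works in
        favour of the inequality.\<close>
      have "?z * (alive a K \<omega> - alive a (Suc K) \<omega>) + ?Z (Suc K) \<omega> \<le> alive a K \<omega> * exp (- \<gamma> * walk (Suc K) \<omega>)"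
        using \<gamma>_pos by (cases rule: alive_cases[of a K \<omega>]) (auto simp: alive_Suc)
      then have "?e * (?z * (alive a K \<omega> - alive a (Suc K) \<omega>) + ?Z (Suc K) \<omega>)
          \<le> ?e * (alive a K \<omega> * exp (- \<gamma> * walk (Suc K) \<omega>))"
        by (rule mult_left_mono) simp
      then show ?thesis by (simp add: hit_discount_def algebra_simps)
    qed
    have "?z * expectation (hit_discount a (Suc K)) + ?e * expectation (?Z (Suc K))
        = expectation (\<lambda>\<omega>. ?z * hit_discount a (Suc K) \<omega> + ?e * ?Z (Suc K) \<omega>)"
      using intR[of "Suc K"] intZ[of "Suc K"] by simp
    also have "\<dots> \<le> expectation (\<lambda>\<omega>. ?z * hit_discount a K \<omega> + ?e * (alive a K \<omega> * exp (- \<gamma> * walk (Suc K) \<omega>)))"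
      by (rule integral_mono) (use intR intZ os pt in auto)
    also have "\<dots> = ?z * expectation (hit_discount a K)
        + ?e * expectation (\<lambda>\<omega>. alive a K \<omega> * exp (- \<gamma> * walk (Suc K) \<omega>))"
      using intR[of K] os by simp
    \<comment> \<open>At the rate \<open>cbar\<close> the one-step factor is the constant
      \<open>exp (r * h)\<close>, which cancels the additional discount.\<close>
    also have "expectation (\<lambda>\<omega>. alive a K \<omega> * exp (- \<gamma> * walk (Suc K) \<omega>))
        = expectation (\<lambda>\<omega>. ?Z K \<omega> * exp (r * h))"
      using os by (simp add: const mult.assoc)
    also have "\<dots> = expectation (?Z K) * exp (r * h)"
      by simp
    also have "?e * (expectation (?Z K) * exp (r * h)) = exp (- r * (real K * h)) * expectation (?Z K)"
    proof -
      have "?e * exp (r * h) = exp (- r * (real K * h))"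
        unfolding exp_add[symmetric] by (simp add: algebra_simps)
      then show ?thesis by (simp add: mult.commute mult.left_commute)
    qed
    finally show ?case using Suc by linarith
  qed
  moreover have "0 \<le> exp (- r * (real K * h)) * expectation (?Z K)"
    by (intro mult_nonneg_nonneg integral_nonneg_AE AE_I2) auto
  ultimately have "?z * expectation (hit_discount a K) \<le> exp (- \<gamma> * x)" by linarith
  then have "exp (\<gamma> * a) * (?z * expectation (hit_discount a K)) \<le> exp (\<gamma> * a) * exp (- \<gamma> * x)"
    by (rule mult_left_mono) simp
  then show ?thesis unfolding mult.assoc[symmetric] exp_add[symmetric] by simp
qed

lemma surplus_le_walk:
  assumes "\<omega> \<in> space M"
  shows "surplus \<mu> \<sigma> W x D (real k * h) \<omega> \<le> walk k \<omega>"
proof -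
  have "mono_on {0..} (\<lambda>t. D t \<omega>)" using D assms by (auto simp: ratcheting_strategies_def)
  then have "(LBINT s=0..real k * h. \<mu> - D s \<omega>) \<le> h * (\<Sum>j<k. \<mu> - D (real j * h) \<omega>)"
    by (rule pathwise_drift_le[OF h_pos]) (use rate_bounds[OF assms] cbar_le in force)
  then show ?thesis by (simp add: surplus_def walk_def)
qed

text \<open>The walk dominates the surplus at grid times, so a walk at or below zero forces ruin by
  then, and later cells carry no dividends.\<close>

lemma dividends_le:
  assumes \<omega>: "\<omega> \<in> space M"
  shows "(LBINT t=0..ruin_time \<mu> \<sigma> W x D \<omega>. exp (- r * t) * D t \<omega>) \<le>
    (\<Sum>k<K. exp (- r * (real k * h)) * (alive 0 k \<omega> * (h * D (real k * h) \<omega>)))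
      + (h * cbar + cbar / r * exp (- r * (real K * h)))"
proof -
  let ?a = "\<lambda>k. \<forall>j\<le>k. 0 < walk j \<omega>"
  have "(LBINT t=0..ruin_time \<mu> \<sigma> W x D \<omega>. exp (- r * t) * D t \<omega>) \<le>
    (\<Sum>k<K. of_bool (?a k) * exp (- r * (real k * h)) * (h * D (real k * h) \<omega>))
      + h * cbar + cbar / r * exp (- r * (real K * h))"
  proof (rule pathwise_dividends_le[OF h_pos r_pos])
    show "mono_on {0..} (\<lambda>t. D t \<omega>)" using D \<omega> by (auto simp: ratcheting_strategies_def)
    show "0 \<le> ruin_time \<mu> \<sigma> W x D \<omega>" unfolding ruin_time_def by (rule Inf_greatest) auto
    show "ruin_time \<mu> \<sigma> W x D \<omega> \<le> ereal (real k * h)" if dead: "\<not> ?a k" for k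
    proof -
      obtain j where j: "j \<le> k" "walk j \<omega> \<le> 0" using dead by (auto simp: not_less)
      then have "surplus \<mu> \<sigma> W x D (real j * h) \<omega> \<le> 0" using surplus_le_walk[OF \<omega>, of j] by linarith
      then have "ruin_time \<mu> \<sigma> W x D \<omega> \<le> ereal (real j * h)"
        unfolding ruin_time_def by (intro Inf_lower) auto
      also have "\<dots> \<le> ereal (real k * h)" using j h_pos by simp
      finally show ?thesis .
    qed
  qed (use rate_bounds[OF \<omega>] in auto)
  then show ?thesis by (simp add: alive_def mult.assoc mult.left_commute)
qed

lemma expected_dividends_le_grid:
  assumes "0 \<le> x" "0 < \<delta>" "1 \<le> L"
  shows "expected_dividends M W \<mu> \<sigma> r x D \<le>
    cbar / r * (1 - exp (- \<gamma> * (x + \<delta>))) + (1 + r * h) / (r * h) *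
      (cbar * r * h\<^sup>2 + cbar / r * (exp (- (L * \<gamma> * \<delta>)) * exp ((L * \<gamma> * \<sigma>)\<^sup>2 * h / 2)))
    + (h * cbar + cbar / r * exp (- r * (real K * h)))"
proof -
  define c where "c = h * cbar + cbar / r * exp (- r * (real K * h))"
  define S where "S = (\<lambda>\<omega>. \<Sum>k<K. exp (- r * (real k * h)) * (alive 0 k \<omega> * (h * D (real k * h) \<omega>)))"
  have c0: "0 \<le> c" using cbar_nonneg r_pos h_pos by (simp add: c_def)
  have intD: "integrable M (\<lambda>\<omega>. alive 0 k \<omega> * (h * D (real k * h) \<omega>))" for k
  proof (rule integrable_alive_mult[where B="h * cbar"])
    fix \<omega> assume \<omega>: "\<omega> \<in> space M"
    show "\<bar>h * D (real k * h) \<omega>\<bar> \<le> h * cbar"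
      using rate_bounds[OF \<omega>, of "real k * h"] h_pos by (simp add: abs_mult)
  qed measurable
  have intS: "integrable M S"
    unfolding S_def by (intro Bochner_Integration.integrable_sum integrable_mult_right intD)
  have S0: "0 \<le> S \<omega>" if "\<omega> \<in> space M" for \<omega>
    unfolding S_def using rate_bounds[OF that] h_pos
    by (intro sum_nonneg mult_nonneg_nonneg) auto
  \<comment> \<open>\<open>S + c\<close> is integrable and nonnegative, so the comparison also
    covers non-integrable dividends, whose integral is 0 by convention.\<close>
  have "expected_dividends M W \<mu> \<sigma> r x D \<le> expectation (\<lambda>\<omega>. S \<omega> + c)"
    unfolding expected_dividends_def
    by (rule integral_mono') (use intS S0 c0 dividends_le[of _ K] in \<open>auto simp: S_def c_def\<close>)
  also have "\<dots> = expectation S + c" using intS by (simp add: prob_space)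
  also have "expectation S = (\<Sum>k<K. exp (- r * (real k * h)) * expectation (\<lambda>\<omega>. alive 0 k \<omega> * (h * D (real k * h) \<omega>)))"
    unfolding S_def using intD by (simp add: Bochner_Integration.integral_sum)
  also have "\<dots> \<le> cbar / r * (1 - exp (- \<gamma> * (x + \<delta>))) + (1 + r * h) / (r * h) *
      (cbar * r * h\<^sup>2 + cbar / r * (exp (- (L * \<gamma> * \<delta>)) * exp ((L * \<gamma> * \<sigma>)\<^sup>2 * h / 2)))"
    using assms by (intro expected_payments_le)
  finally show ?thesis unfolding c_def by simp
qed

end

section \<open>The upper bound for every strategy, by refining the grid\<close>

context ratcheting_problem
begin

lemma expected_dividends_le:
  assumes D: "D \<in> ratcheting_strategies M W cbar 0" and "0 \<le> x"
  shows "expected_dividends M W \<mu> \<sigma> r x D \<le> g_fun \<mu> \<sigma> r cbar x"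
proof -
  let ?E = "expected_dividends M W \<mu> \<sigma> r x D"
  have shifted: "?E \<le> cbar / r * (1 - exp (- \<gamma> * (x + \<delta>)))" if "\<delta> > 0" for \<delta>
  proof -
    \<comment> \<open>The parameters are \<open>h = 1 / n\<^sup>2\<close>, \<open>L = n\<close> and
      \<open>K = n ^ 3\<close>. The horizon \<open>K * h = n\<close> then grows, the Gaussian factor
      stays at \<open>exp ((\<gamma> * \<sigma>)\<^sup>2 / 2)\<close>, and
      \<open>exp (- \<gamma> * \<delta> * n)\<close> beats the number of effective steps, of order
      \<open>n\<^sup>2\<close>. All errors carry a factor \<open>cbar\<close>, and
      \<open>B n\<close> is what remains.\<close>
    define h where "h = (\<lambda>n::nat. 1 / real n ^ 2)"
    define B where "B = (\<lambda>n. (real n ^ 2 / r + 1) * (r / real n ^ 4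
        + 1 / r * (exp (- ((\<gamma> * \<delta>) * real n)) * exp ((\<gamma> * \<sigma>)\<^sup>2 / 2)))
        + (1 / real n ^ 2 + 1 / r * exp (- (r * real n))))"
    have "\<forall>\<^sub>F n in sequentially. ?E \<le> cbar / r * (1 - exp (- \<gamma> * (x + \<delta>))) + cbar * B n"
      using eventually_gt_at_top[of 0]
    proof eventually_elim
      case (elim n)
      interpret grid_walk M W \<mu> \<sigma> r cbar D "h n" x
        using elim D by unfold_locales (auto simp: h_def)
      have eqs: "(1 + r * h n) / (r * h n) = real n ^ 2 / r + 1" "r * (h n)\<^sup>2 = r / real n ^ 4"
        "(real n * \<gamma> * \<sigma>)\<^sup>2 * h n / 2 = (\<gamma> * \<sigma>)\<^sup>2 / 2" "real n * \<gamma> * \<delta> = (\<gamma> * \<delta>) * real n"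
        "- r * (real (n ^ 3) * h n) = - (r * real n)"
        using elim r_pos by (simp_all add: h_def field_simps power2_eq_square eval_nat_numeral)
      have "(1 + r * h n) / (r * h n) * (cbar * (r * (h n)\<^sup>2)
            + cbar / r * (exp (- (real n * \<gamma> * \<delta>)) * exp ((real n * \<gamma> * \<sigma>)\<^sup>2 * h n / 2)))
          + (h n * cbar + cbar / r * exp (- r * (real (n ^ 3) * h n))) = cbar * B n"
        unfolding eqs B_def unfolding h_def by (simp add: distrib_left mult.left_commute)
      then show ?case
        using expected_dividends_le_grid[OF assms(2) that, of "real n" "n ^ 3"] elim
        by (simp only: mult.assoc add.assoc)
    qed
    moreover have "B \<longlonglongrightarrow> 0"
    proof -
      define a where "a = \<gamma> * \<delta>"
      define C where "C = exp ((\<gamma> * \<sigma>)\<^sup>2 / 2)"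
      have "a > 0" "C > 0" unfolding a_def C_def using \<gamma>_pos that by auto
      then show ?thesis
        unfolding B_def a_def[symmetric] C_def[symmetric] using r_pos by real_asymp
    qed
    then have "(\<lambda>n. cbar / r * (1 - exp (- \<gamma> * (x + \<delta>))) + cbar * B n)
        \<longlonglongrightarrow> cbar / r * (1 - exp (- \<gamma> * (x + \<delta>))) + cbar * 0"
      by (intro tendsto_intros)
    ultimately show ?thesis
      using tendsto_lowerbound[of _ _ sequentially ?E] by fastforce
  qed
  have "((\<lambda>\<delta>. cbar / r * (1 - exp (- \<gamma> * (x + \<delta>)))) \<longlongrightarrow> cbar / r * (1 - exp (- \<gamma> * (x + 0)))) (at_right 0)"
    by (intro tendsto_intros)
  moreover have "\<forall>\<^sub>F \<delta> in at_right 0. ?E \<le> cbar / r * (1 - exp (- \<gamma> * (x + \<delta>)))"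
    using eventually_at_right_less[of 0] by eventually_elim (rule shifted)
  ultimately show ?thesis
    unfolding g_fun_def using tendsto_lowerbound[of _ _ "at_right 0" ?E] by fastforce
qed

section \<open>The ruin time and the lower bound at the constant rate\<close>

context
  fixes x :: real
  assumes x: "0 \<le> x"
begin

private abbreviation Y :: "real \<Rightarrow> 'a \<Rightarrow> real" where
  "Y t \<omega> \<equiv> x + (\<mu> - cbar) * t + \<sigma> * W t \<omega>"

private abbreviation \<tau> :: "'a \<Rightarrow> ereal" where
  "\<tau> \<equiv> ruin_time \<mu> \<sigma> W x (\<lambda>t \<omega>. cbar)"

private lemma surplus_const: "0 \<le> t \<Longrightarrow> surplus \<mu> \<sigma> W x (\<lambda>t \<omega>. cbar) t \<omega> = Y t \<omega>"
  by (simp add: surplus_def zero_ereal_def)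

private lemma \<tau>_eq: "\<tau> \<omega> = Inf (ereal ` {t. 0 \<le> t \<and> Y t \<omega> \<le> 0})"
  unfolding ruin_time_def using surplus_const by (intro arg_cong[where f=Inf] image_cong) auto

private lemma \<tau>_nonneg: "0 \<le> \<tau> \<omega>"
  unfolding \<tau>_eq by (rule Inf_greatest) auto

private lemma continuous_Y:
  assumes "continuous_on {0..} (\<lambda>t. W t \<omega>)"
  shows "continuous_on {0..} (\<lambda>t. Y t \<omega>)"
  using assms by (intro continuous_intros)

text \<open>For a continuous path the times of nonpositive surplus form a closed set, which contains
  its infimum when it is nonempty.\<close>

private lemma ruin_attained:
  assumes cont: "continuous_on {0..} (\<lambda>t. W t \<omega>)" and fin: "\<tau> \<omega> < \<infinity>"
  obtains s where "0 \<le> s" "\<tau> \<omega> = ereal s" "Y s \<omega> \<le> 0"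
proof -
  let ?S = "{t. 0 \<le> t \<and> Y t \<omega> \<le> 0}"
  have ne: "?S \<noteq> {}"
  proof
    assume e: "?S = {}"
    show False using fin unfolding \<tau>_eq e by (simp add: top_ereal_def)
  qed
  have "closed ({0..} \<inter> (\<lambda>t. Y t \<omega>) -` {..0})"
    using continuous_Y[OF cont] by (intro continuous_closed_preimage) auto
  moreover have "{0..} \<inter> (\<lambda>t. Y t \<omega>) -` {..0} = ?S" by auto
  ultimately have cl: "closed ?S" by simp
  have bb: "bdd_below ?S" by (rule bdd_belowI[of _ 0]) auto
  have mem: "Inf ?S \<in> ?S" by (rule closed_contains_Inf[OF ne bb cl])
  have "\<tau> \<omega> = ereal (Inf ?S)"
    unfolding \<tau>_eq
  proof (rule antisym)
    show "Inf (ereal ` ?S) \<le> ereal (Inf ?S)" using mem by (intro Inf_lower) auto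
    show "ereal (Inf ?S) \<le> Inf (ereal ` ?S)"
      using cInf_lower[OF _ bb] by (intro Inf_greatest) auto
  qed
  with mem show ?thesis using that by blast
qed

text \<open>Reduces ruin by time \<open>u\<close> to countably many times. Forwards, a rational time
  is taken just to the right of the ruin time, which is why \<open>u\<close> itself is added for
  ruin exactly at \<open>u\<close>. Backwards, the minimum over the compact interval is attained and
  lies below every \<open>1 / Suc m\<close>.\<close>

private lemma ruin_le_iff:
  assumes cont: "continuous_on {0..} (\<lambda>t. W t \<omega>)" and "0 \<le> u"
  shows "\<tau> \<omega> \<le> ereal u \<longleftrightarrow> (\<forall>m. \<exists>q\<in>insert u (\<rat> \<inter> {0..u}). Y q \<omega> < 1 / real (Suc m))"
proof
  assume le: "\<tau> \<omega> \<le> ereal u"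
  then have "\<tau> \<omega> < \<infinity>" by auto
  with cont obtain s where s: "0 \<le> s" "\<tau> \<omega> = ereal s" "Y s \<omega> \<le> 0" by (rule ruin_attained)
  then have "s \<le> u" using le by simp
  show "\<forall>m. \<exists>q\<in>insert u (\<rat> \<inter> {0..u}). Y q \<omega> < 1 / real (Suc m)"
  proof
    fix m
    show "\<exists>q\<in>insert u (\<rat> \<inter> {0..u}). Y q \<omega> < 1 / real (Suc m)"
    proof (cases "s = u")
      case True
      have "Y s \<omega> < 1 / real (Suc m)" using s(3) by (rule le_less_trans) simp
      then show ?thesis using True by blast
    next
      case False
      then have "s < u" using \<open>s \<le> u\<close> by simp
      have "0 < 1 / real (Suc m)" by simp
      then obtain d where d: "d > 0" "\<And>t. t \<in> {0..} \<Longrightarrow> dist t s < d \<Longrightarrow> dist (Y t \<omega>) (Y s \<omega>) < 1 / real (Suc m)"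
        using continuous_Y[OF cont] s(1) unfolding continuous_on_iff by (metis atLeast_iff)
      obtain q where q: "q \<in> \<rat>" "s < q" "q < min u (s + d)"
        using Rats_dense_in_real[of s "min u (s + d)"] \<open>s < u\<close> d(1) by auto
      then have "dist (Y q \<omega>) (Y s \<omega>) < 1 / real (Suc m)"
        using d(2)[of q] s(1) by (auto simp: dist_real_def)
      then have "Y q \<omega> < 1 / real (Suc m)" using s(3) unfolding dist_real_def by linarith
      then show ?thesis using q s(1) by (intro bexI[of _ q]) auto
    qed
  qed
next
  assume R: "\<forall>m. \<exists>q\<in>insert u (\<rat> \<inter> {0..u}). Y q \<omega> < 1 / real (Suc m)"
  have "continuous_on {0..u} (\<lambda>t. Y t \<omega>)"
    using continuous_on_subset[OF continuous_Y[OF cont]] by auto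
  then obtain s where s: "s \<in> {0..u}" "\<And>t. t \<in> {0..u} \<Longrightarrow> Y s \<omega> \<le> Y t \<omega>"
    using continuous_attains_inf[of "{0..u}" "\<lambda>t. Y t \<omega>"] \<open>0 \<le> u\<close> by auto
  have "Y s \<omega> \<le> 0"
  proof (rule ccontr)
    assume "\<not> Y s \<omega> \<le> 0"
    then obtain m where m: "1 / real (Suc m) < Y s \<omega>"
      using reals_Archimedean[of "Y s \<omega>"] by (auto simp: inverse_eq_divide)
    obtain q where "q \<in> {0..u}" "Y q \<omega> < 1 / real (Suc m)" using R \<open>0 \<le> u\<close> by force
    then show False using s(2)[of q] m by linarith
  qed
  then have "\<tau> \<omega> \<le> ereal s" unfolding \<tau>_eq using s by (intro Inf_lower) auto
  also have "\<dots> \<le> ereal u" using s by simp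
  finally show "\<tau> \<omega> \<le> ereal u" .
qed

text \<open>Paths are continuous only almost surely, so the countable description gives each event
  up to a null set; completeness of \<open>M\<close> then makes the event itself measurable.\<close>

lemma ruin_time_measurable: "\<tau> \<in> borel_measurable M"
  unfolding borel_measurable_iff_Iic_ereal
proof
  fix b :: ereal
  have real_case: "\<tau> -` {..ereal u} \<inter> space M \<in> sets M" if "0 \<le> u" for u
  proof -
    let ?Q = "insert u (\<rat> \<inter> {0..u})"
    let ?A = "{\<omega> \<in> space M. \<forall>m. \<exists>q\<in>?Q. Y q \<omega> < 1 / real (Suc m)}"
    have cQ: "countable ?Q" using countable_rat by blast
    have A: "?A \<in> sets M"
    proof (rule sets.sets_Collect_countable_All, rule sets.sets_Collect_countable_Ex'[OF _ cQ])
      fix m q assume "q \<in> ?Q"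
      then have [measurable]: "W q \<in> borel_measurable M" using measurable_W that by auto
      show "{\<omega> \<in> space M. Y q \<omega> < 1 / real (Suc m)} \<in> sets M" by measurable
    qed
    have ae: "AE \<omega> in M. \<omega> \<in> ?A \<longleftrightarrow> \<omega> \<in> \<tau> -` {..ereal u} \<inter> space M"
      using continuous_paths AE_space
    proof eventually_elim
      case (elim \<omega>)
      then show ?case using ruin_le_iff[OF elim(1) that] by auto
    qed
    show ?thesis by (rule in_sets_AE[OF ae A]) (rule Int_lower2)
  qed
  show "\<tau> -` {..b} \<inter> space M \<in> sets M"
  proof (cases "0 \<le> b")
    case False
    then have "\<not> \<tau> \<omega> \<le> b" for \<omega> using order_trans[OF \<tau>_nonneg] by blast
    then have "\<tau> -` {..b} \<inter> space M = {}" by (simp add: vimage_def)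
    then show ?thesis by (simp only: sets.empty_sets)
  next
    case True
    show ?thesis
    proof (cases b)
      case (real u)
      then show ?thesis using real_case[of u] True by simp
    next
      case PInf
      have "\<tau> -` {..b} \<inter> space M = space M" using PInf by (simp add: vimage_def)
      then show ?thesis by (simp only: sets.top)
    next
      case MInf
      then show ?thesis using True by simp
    qed
  qed
qed

lemma discount_ruin_measurable: "(\<lambda>\<omega>. discount r (\<tau> \<omega>)) \<in> borel_measurable M"
  by (rule measurable_compose[OF ruin_time_measurable discount_measurable])

lemma discount_01: "0 \<le> discount r (\<tau> \<omega>)" "discount r (\<tau> \<omega>) \<le> 1"
  using \<tau>_nonneg[of \<omega>] r_pos by (auto simp: discount_def real_of_ereal_pos)

lemma const_strategy: "c \<le> cbar \<Longrightarrow> (\<lambda>t \<omega>. cbar) \<in> ratcheting_strategies M W cbar c"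
  by (auto simp: ratcheting_strategies_def mono_on_def)

text \<open>The walk on a fine grid enters \<open>(-\<infinity>, a]\<close> before ruin, so that Fatou's lemma applies to the
  discount factors at these entrance times.\<close>

lemma expectation_discount_le_shifted:
  assumes a: "0 < a"
  shows "expectation (\<lambda>\<omega>. discount r (\<tau> \<omega>)) \<le> exp (\<gamma> * a - \<gamma> * x)"
proof -
  define h where "h = (\<lambda>n. 1 / real (Suc n))"
  have h: "h n > 0" for n by (simp add: h_def)
  have gw: "grid_walk M W \<mu> \<sigma> r cbar (\<lambda>t \<omega>. cbar) (h n)" for n
    using const_strategy[of 0] cbar_nonneg h by unfold_locales auto
  \<comment> \<open>With \<open>Suc n ^ 2\<close> steps of length \<open>1 / Suc n\<close> the
    horizon is \<open>Suc n\<close>, so mesh and horizon improve together.\<close>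
  define R where "R = (\<lambda>n. grid_walk.hit_discount W \<mu> \<sigma> r (\<lambda>t \<omega>. cbar) (h n) x a (Suc n ^ 2))"
  have R_int: "integrable M (R n)" and R_nonneg: "0 \<le> R n \<omega>"
    and R_le: "expectation (R n) \<le> exp (\<gamma> * a - \<gamma> * x)" for n \<omega>
    unfolding R_def using grid_walk.integrable_hit_discount[OF gw] grid_walk.hit_discount_nonneg[OF gw]
      grid_walk.expectation_hit_discount_le[OF gw] a x by auto
  have lim: "AE \<omega> in M. ennreal (discount r (\<tau> \<omega>)) \<le> liminf (\<lambda>n. ennreal (R n \<omega>))"
    using continuous_paths
  proof eventually_elim
    case (elim \<omega>)
    show ?case
    proof (cases "\<tau> \<omega> = \<infinity>")
      case True
      then show ?thesis by (simp add: discount_def)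
    next
      case False
      then have "\<tau> \<omega> < \<infinity>" by (simp add: less_top)
      with elim obtain s where s: "0 \<le> s" "\<tau> \<omega> = ereal s" "Y s \<omega> \<le> 0" by (rule ruin_attained)
      obtain d where d: "d > 0" "\<And>t. t \<in> {0..} \<Longrightarrow> dist t s < d \<Longrightarrow> dist (Y t \<omega>) (Y s \<omega>) < a"
        using continuous_Y[OF elim] s(1) a unfolding continuous_on_iff by (metis atLeast_iff)
      have "h \<longlonglongrightarrow> 0" unfolding h_def by real_asymp
      then have "\<forall>\<^sub>F n in sequentially. h n < d" using d(1) by (rule order_tendstoD)
      moreover have "\<forall>\<^sub>F n in sequentially. s < real (Suc n)"
        using eventually_ge_at_top[of "nat \<lceil>s\<rceil>"] by eventually_elim linarith
      ultimately have "\<forall>\<^sub>F n in sequentially. discount r (\<tau> \<omega>) \<le> R n \<omega>"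
      proof eventually_elim
        case (elim n)
        interpret grid_walk M W \<mu> \<sigma> r cbar "\<lambda>t \<omega>. cbar" "h n" x by (rule gw)
        have "real (Suc n ^ 2) * h n = real (Suc n)"
          by (simp add: h_def power2_eq_square field_simps)
        \<comment> \<open>The last grid point not after the ruin time \<open>s\<close>: by
          continuity the surplus there is at most \<open>a\<close>, and stopping at or before
          \<open>s\<close> gives a discount factor no smaller than that at ruin.\<close>
        then obtain k where k: "k < Suc n ^ 2" "real k * h n \<le> s" "s < real (Suc k) * h n"
          using grid_index[OF h s(1), of "Suc n ^ 2" n] elim(2) by auto
        then have "dist (real k * h n) s < d" using elim(1) by (simp add: dist_real_def algebra_simps)
        then have "dist (Y (real k * h n) \<omega>) (Y s \<omega>) < a" by (intro d) simp_all
        then have "Y (real k * h n) \<omega> \<le> a" using s(3) unfolding dist_real_def by linarith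
        moreover have "walk k \<omega> = Y (real k * h n) \<omega>" by (simp add: walk_def algebra_simps)
        ultimately show ?case
          unfolding R_def using hit_discount_ge[of k "Suc n ^ 2" \<omega> a s] k s(2) by (simp add: discount_def)
      qed
      then show ?thesis by (intro Liminf_bounded) (auto elim: eventually_mono intro: ennreal_leI)
    qed
  qed
  have "ennreal (expectation (\<lambda>\<omega>. discount r (\<tau> \<omega>))) = (\<integral>\<^sup>+\<omega>. ennreal (discount r (\<tau> \<omega>)) \<partial>M)"
    using discount_ruin_measurable discount_01
    by (intro nn_integral_eq_integral[symmetric] integrable_const_bound[where B=1]) auto
  also have "\<dots> \<le> (\<integral>\<^sup>+\<omega>. liminf (\<lambda>n. ennreal (R n \<omega>)) \<partial>M)"
    by (rule nn_integral_mono_AE[OF lim])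
  also have "\<dots> \<le> liminf (\<lambda>n. \<integral>\<^sup>+\<omega>. ennreal (R n \<omega>) \<partial>M)"
    using R_int by (intro nn_integral_liminf) auto
  also have "\<dots> \<le> liminf (\<lambda>n. ennreal (exp (\<gamma> * a - \<gamma> * x)))"
    using nn_integral_eq_integral[OF R_int] R_nonneg R_le by (intro Liminf_mono) (simp add: ennreal_leI)
  also have "\<dots> = ennreal (exp (\<gamma> * a - \<gamma> * x))" by (rule Liminf_const) simp
  finally show ?thesis by simp
qed

lemma expectation_discount_le: "expectation (\<lambda>\<omega>. discount r (\<tau> \<omega>)) \<le> exp (- \<gamma> * x)"
proof -
  have "((\<lambda>a. exp (\<gamma> * a - \<gamma> * x)) \<longlongrightarrow> exp (\<gamma> * 0 - \<gamma> * x)) (at_right 0)"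
    by (intro tendsto_intros)
  moreover have "\<forall>\<^sub>F a in at_right 0. expectation (\<lambda>\<omega>. discount r (\<tau> \<omega>)) \<le> exp (\<gamma> * a - \<gamma> * x)"
    using eventually_at_right_less[of 0] by eventually_elim (rule expectation_discount_le_shifted)
  ultimately show ?thesis
    using tendsto_lowerbound[of _ _ "at_right 0" "expectation (\<lambda>\<omega>. discount r (\<tau> \<omega>))"] by fastforce
qed

lemma expected_dividends_const_ge:
  "g_fun \<mu> \<sigma> r cbar x \<le> expected_dividends M W \<mu> \<sigma> r x (\<lambda>t \<omega>. cbar)"
proof -
  have int: "integrable M (\<lambda>\<omega>. discount r (\<tau> \<omega>))"
    using discount_ruin_measurable discount_01 by (intro integrable_const_bound[where B=1]) auto
  have "expected_dividends M W \<mu> \<sigma> r x (\<lambda>t \<omega>. cbar) = expectation (\<lambda>\<omega>. cbar / r * (1 - discount r (\<tau> \<omega>)))"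
    unfolding expected_dividends_def using constant_dividends[OF \<tau>_nonneg r_pos] by simp
  also have "\<dots> = cbar / r * (1 - expectation (\<lambda>\<omega>. discount r (\<tau> \<omega>)))"
    using int by (simp add: prob_space)
  also have "\<dots> \<ge> cbar / r * (1 - exp (- \<gamma> * x))"
    using expectation_discount_le cbar_nonneg r_pos by (intro mult_left_mono) auto
  finally show ?thesis by (simp add: g_fun_def)
qed

end

end

theorem theorem2p2:
  fixes M :: "'a measure" and W :: "real \<Rightarrow> 'a \<Rightarrow> real" and \<mu> \<sigma> r cbar :: real
  assumes "standard_brownian_motion M W"
    and "\<mu> > 0" and "\<sigma> > 0" and "r > 0" and "0 \<le> cbar" and "cbar \<le> \<mu>"
    and "2 * \<mu> * cbar \<le> \<sigma>\<^sup>2 * r"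
  shows "\<forall>x\<ge>0. \<forall>c\<in>{0..cbar}.
    value_function M W \<mu> \<sigma> r cbar x c = g_fun \<mu> \<sigma> r cbar x \<and>
    optimal_strategy M W \<mu> \<sigma> r cbar x c (\<lambda>t \<omega>. cbar)"
proof (intro allI impI ballI)
  fix x c :: real
  assume x: "0 \<le> x" and c: "c \<in> {0..cbar}"
  interpret ratcheting_problem M W \<mu> \<sigma> r cbar
    using assms by (intro ratcheting_problem.intro ratcheting_problem_axioms.intro)
  let ?C = "\<lambda>t (\<omega>::'a). cbar" and ?J = "expected_dividends M W \<mu> \<sigma> r x"
  \<comment> \<open>A larger initial rate \<open>c\<close> only shrinks the class of strategies, so
    the bound for lower rate 0 covers every \<open>c\<close>.\<close>
  have upper: "?J D \<le> g_fun \<mu> \<sigma> r cbar x" if "D \<in> ratcheting_strategies M W cbar c" for D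
    using that c x by (intro expected_dividends_le) (auto simp: ratcheting_strategies_def intro: order_trans)
  have C: "?C \<in> ratcheting_strategies M W cbar c"
    using c by (intro const_strategy) auto
  have J: "?J ?C = g_fun \<mu> \<sigma> r cbar x"
    using upper[OF C] expected_dividends_const_ge[OF x] by (rule antisym)
  have V: "value_function M W \<mu> \<sigma> r cbar x c = g_fun \<mu> \<sigma> r cbar x"
    unfolding value_function_def
  proof (rule antisym)
    show "(SUP D\<in>ratcheting_strategies M W cbar c. ?J D) \<le> g_fun \<mu> \<sigma> r cbar x"
      using C upper by (intro cSUP_least) auto
    show "g_fun \<mu> \<sigma> r cbar x \<le> (SUP D\<in>ratcheting_strategies M W cbar c. ?J D)"
      unfolding J[symmetric] using C upper by (intro cSUP_upper bdd_aboveI2)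
  qed
  then show "value_function M W \<mu> \<sigma> r cbar x c = g_fun \<mu> \<sigma> r cbar x \<and>
      optimal_strategy M W \<mu> \<sigma> r cbar x c ?C"
    using upper C J by (simp add: optimal_strategy_def)
qed

end
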